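(* Let $(\zeta(x))_{x>0}$ be the process defined in the context. Then almost surely, for every $0<a<b<\infty$, the total variation of $x\mapsto\zeta(x)$ over $[a,b]$ is finite.
   Context: Let $\mathcal{G}$ be the space of Lipschitz functions $f:\mathbb{R}\to\mathbb{R}$ with the norm $|f(0)|+L_f$, where $L_f=\sup_{x\neq y}|f(y)-f(x)|/|x-y|$, and its Borel $\sigma$-algebra. Let $\nu$ be a probability measure on $\mathcal{G}$, $f$ a random element with distribution $\nu$, and assume $\mathbf{E}L_f<\infty$, $\mathbf{E}\log L_f<0$ and $\mathbf{E}|f(z_0)-z_0|<\infty$ for a fixed $z_0\in\mathbb{R}$. Let $\mathcal{P}$ be a Poisson process on $[0,\infty)\times[0,\infty)\times\mathcal{G}$ with intensity $\mathrm{Leb}\otimes\mathrm{Leb}\otimes\nu$. For $x>0$, enumerate the points $(t_k,x_k,f_k)$ of $\mathcal{P}$ with $x_k\le x$ so that $t_1<t_2<\cdots$, let $N_x(t)$ be the number of them with $t_k\le t$, and set $\zeta_t(x)=f_1\circ\cdots\circ f_{N_x(t)}(z_0)$. Almost surely the limit $\zeta(x)=\lim_{t\to\infty}\zeta_t(x)$ exists simultaneously for all $x>0$ (and does not depend on $z_0$). *)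

theory Defs
  imports "HOL-Probability.Probability"
begin

definition lipG :: "(real \<Rightarrow> real) set" where
  "lipG = {f. \<exists>L. \<forall>x y. \<bar>f y - f x\<bar> \<le> L * \<bar>y - x\<bar>}"

definition lipconst :: "(real \<Rightarrow> real) \<Rightarrow> real" where
  "lipconst f = (SUP p \<in> {p :: real \<times> real. fst p \<noteq> snd p}.
                    \<bar>f (snd p) - f (fst p)\<bar> / \<bar>fst p - snd p\<bar>)"

definition lipnorm :: "(real \<Rightarrow> real) \<Rightarrow> real" where
  "lipnorm f = \<bar>f 0\<bar> + lipconst f"

definition G_open :: "(real \<Rightarrow> real) set \<Rightarrow> bool" where
  "G_open U \<longleftrightarrow> U \<subseteq> lipG \<and>
     (\<forall>f\<in>U. \<exists>e>0. \<forall>g\<in>lipG. lipnorm (\<lambda>z. g z - f z) < e \<longrightarrow> g \<in> U)"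

definition G_borel :: "(real \<Rightarrow> real) measure" where
  "G_borel = sigma lipG {U. G_open U}"

definition log_pos :: "real \<Rightarrow> ennreal" where
  "log_pos L = ennreal (max 0 (ln L))"   (* only used for L > 0 *)

definition log_neg :: "real \<Rightarrow> ennreal" where
  "log_neg L = (if L = 0 then \<infinity> else ennreal (max 0 (- ln L)))"

text \<open>E log L_f < 0, where E (log L_f)^+ \<le> E L_f < \<infinity> under the standing
  assumption, so this means E log L_f = E (log L_f)^+ - E (log L_f)^- < 0.\<close>
definition exp_log_lip_neg :: "(real \<Rightarrow> real) measure \<Rightarrow> bool" where
  "exp_log_lip_neg \<nu> \<longleftrightarrow>
     (\<integral>\<^sup>+ f. (if lipconst f = 0 then 0 else log_pos (lipconst f)) \<partial>\<nu>)
       < (\<integral>\<^sup>+ f. log_neg (lipconst f) \<partial>\<nu>)"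

definition poisson_process :: "'w measure \<Rightarrow> ('w \<Rightarrow> 'b set) \<Rightarrow> 'b measure \<Rightarrow> bool" where
  "poisson_process M P \<mu> \<longleftrightarrow>
     prob_space M \<and>
     (\<forall>\<omega>\<in>space M. P \<omega> \<subseteq> space \<mu>) \<and>
     (\<forall>A\<in>sets \<mu>. emeasure \<mu> A < \<infinity> \<longrightarrow>
        (AE \<omega> in M. finite (P \<omega> \<inter> A)) \<and>
        (\<forall>k::nat. measure M {\<omega>\<in>space M. card (P \<omega> \<inter> A) = k}
                   = (measure \<mu> A) ^ k / fact k * exp (- measure \<mu> A))) \<and>
     (\<forall>(I::nat set) A. finite I \<longrightarrow> (\<forall>i\<in>I. A i \<in> sets \<mu> \<and> emeasure \<mu> (A i) < \<infinity>) \<longrightarrow>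
        disjoint_family_on A I \<longrightarrow>
        prob_space.indep_vars M (\<lambda>_. count_space (UNIV :: nat set))
           (\<lambda>i \<omega>. card (P \<omega> \<inter> A i)) I)"

definition lborel_nonneg :: "real measure" where
  "lborel_nonneg = restrict_space lborel {0..}"

definition intensity :: "(real \<Rightarrow> real) measure \<Rightarrow> (real \<times> real \<times> (real \<Rightarrow> real)) measure" where
  "intensity \<nu> = lborel_nonneg \<Otimes>\<^sub>M (lborel_nonneg \<Otimes>\<^sub>M \<nu>)"

type_synonym point = "real \<times> real \<times> (real \<Rightarrow> real)"

definition pts :: "point set \<Rightarrow> real \<Rightarrow> real \<Rightarrow> point set" where
  "pts S x t = {p \<in> S. fst p \<le> t \<and> fst (snd p) \<le> x}"

definition mark :: "point set \<Rightarrow> real \<Rightarrow> real \<Rightarrow> (real \<Rightarrow> real)" where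
  "mark S x \<tau> = (THE f. \<exists>y. (\<tau>, y, f) \<in> S \<and> y \<le> x)"

definition zeta_t :: "point set \<Rightarrow> real \<Rightarrow> real \<Rightarrow> real \<Rightarrow> real" where
  "zeta_t S z0 x t =
     foldr (\<lambda>\<tau> acc. mark S x \<tau> acc) (sorted_list_of_set (fst ` pts S x t)) z0"

definition zeta :: "point set \<Rightarrow> real \<Rightarrow> real \<Rightarrow> real" where
  "zeta S z0 x = Lim at_top (\<lambda>t. zeta_t S z0 x t)"

definition total_variation :: "(real \<Rightarrow> real) \<Rightarrow> real \<Rightarrow> real \<Rightarrow> ereal" where
  "total_variation g a b = (SUP (n, x) \<in> {(n :: nat, x :: nat \<Rightarrow> real).
        x 0 = a \<and> x n = b \<and> (\<forall>i<n. x i \<le> x (Suc i))}.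
        ereal (\<Sum>i<n. \<bar>g (x (Suc i)) - g (x i)\<bar>))"

end

theory Submission
  imports Defs
begin

text \<open>For \<open>x\<close> ranging over \<open>[a, b]\<close>, adding one more map \<open>f\<close> in front of a finite
  composition multiplies its variation over \<open>[a, b]\<close> by \<open>L\<^sub>f\<close> if \<open>f\<close> acts for every
  \<open>x \<ge> a\<close>. Otherwise it multiplies the variation plus the distance to \<open>z\<^sub>0\<close> by at most
  \<open>3 max(1, L\<^sub>f)\<close>, up to an additive term \<open>2 |f(z\<^sub>0) - z\<^sub>0|\<close>. Cutting time into unit slots,
  the variation of the limit is at most a series whose \<open>n\<close>-th term is a product over the Poisson
  points with time below \<open>n + 1\<close>. Since \<open>E log L < 0\<close>, some \<open>s \<in> (0, 1]\<close> has \<open>E L\<^sup>s < 1\<close>,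
  and the exponential formula for Poisson products makes the \<open>s\<close>-th moment of the \<open>n\<close>-th term
  decay exponentially in \<open>n\<close> when \<open>b - a\<close> is small compared with \<open>a\<close>. A general interval is
  covered by finitely many such short ones.\<close>


section \<open>Lipschitz constants\<close>

text \<open>E L may exceed 1, so products of Lipschitz constants need not decay in mean; the
  condition on E log L only yields decay of a possibly fractional moment. A map with
  \<open>a < y \<le> b\<close> acts for some \<open>x\<close> and is the identity for others, so its
  factor cannot be below 1, however contracting the map is. Such maps arrive at rate
  \<open>b - a\<close>, contracting ones at rate \<open>a\<close>, and the balance is
  \<open>(b - a) * \<kappa> < a * (1 - \<rho>)\<close>. Hence only the relative length of the
  interval matters: the cell from \<open>k / N\<close> to \<open>(k + 1) / N\<close> qualifies once
  \<open>k\<close> is large, whatever \<open>N\<close> is. As there are countably many cells, a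
  single null set serves all real \<open>a\<close> and \<open>b\<close>. Existence of the limit is
  not an input. The energy that dominates the variation in \<open>x\<close> also dominates the
  increments of \<open>zeta_t\<close> in time, so convergence and bounded variation come from the
  same series.\<close>

lemma lipconst_bdd:
  assumes "f \<in> lipG"
  shows "bdd_above ((\<lambda>p. \<bar>f (snd p) - f (fst p)\<bar> / \<bar>fst p - snd p\<bar>) ` {p :: real \<times> real. fst p \<noteq> snd p})"
proof -
  obtain L where L: "\<And>x y. \<bar>f y - f x\<bar> \<le> L * \<bar>y - x\<bar>"
    using assms unfolding lipG_def by auto
  show ?thesis
  proof (rule bdd_aboveI2)
    fix p :: "real \<times> real" assume "p \<in> {p. fst p \<noteq> snd p}"
    then have "\<bar>fst p - snd p\<bar> > 0" by auto
    with L[of "snd p" "fst p"] show "\<bar>f (snd p) - f (fst p)\<bar> / \<bar>fst p - snd p\<bar> \<le> L"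
      by (simp add: divide_le_eq abs_minus_commute)
  qed
qed

lemma lipconst_bound:
  assumes "f \<in> lipG"
  shows "\<bar>f y - f x\<bar> \<le> lipconst f * \<bar>y - x\<bar>"
proof (cases "x = y")
  case False
  have "\<bar>f y - f x\<bar> / \<bar>x - y\<bar> \<le> lipconst f"
    unfolding lipconst_def using False
    by (intro cSUP_upper2[OF lipconst_bdd[OF assms], where x = "(x, y)"]) auto
  with False show ?thesis by (simp add: divide_le_eq abs_minus_commute)
qed simp

lemma lipconst_least:
  assumes "\<And>x y. \<bar>f y - f x\<bar> \<le> L * \<bar>y - x\<bar>"
  shows "lipconst f \<le> L"
  unfolding lipconst_def
proof (rule cSUP_least)
  show "{p :: real \<times> real. fst p \<noteq> snd p} \<noteq> {}"
    by (simp add: set_eq_iff) (metis zero_neq_one)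
next
  fix p :: "real \<times> real" assume "p \<in> {p. fst p \<noteq> snd p}"
  then have "\<bar>fst p - snd p\<bar> > 0" by auto
  with assms[of "snd p" "fst p"] show "\<bar>f (snd p) - f (fst p)\<bar> / \<bar>fst p - snd p\<bar> \<le> L"
    by (simp add: divide_le_eq abs_minus_commute)
qed

lemma lipconst_nonneg:
  assumes "f \<in> lipG"
  shows "0 \<le> lipconst f"
  using lipconst_bound[OF assms, of 1 0] by auto

lemma lipG_diff:
  assumes "f \<in> lipG" "g \<in> lipG"
  shows "(\<lambda>z. f z - g z) \<in> lipG"
proof -
  have "\<bar>(f y - g y) - (f x - g x)\<bar> \<le> (lipconst f + lipconst g) * \<bar>y - x\<bar>" for x y
    using lipconst_bound[OF assms(1), of y x] lipconst_bound[OF assms(2), of y x]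
    by (auto simp: algebra_simps)
  then show ?thesis unfolding lipG_def by blast
qed

lemma lipconst_le_diff:
  assumes "f \<in> lipG" "g \<in> lipG"
  shows "lipconst g \<le> lipconst f + lipconst (\<lambda>z. g z - f z)"
proof (rule lipconst_least)
  fix x y
  show "\<bar>g y - g x\<bar> \<le> (lipconst f + lipconst (\<lambda>z. g z - f z)) * \<bar>y - x\<bar>"
    using lipconst_bound[OF assms(1), of y x] lipconst_bound[OF lipG_diff[OF assms(2,1)], of y x]
    by (auto simp: algebra_simps)
qed

lemma lipconst_minus:
  "lipconst (\<lambda>z. g z - f z) = lipconst (\<lambda>z. f z - g z)"
  unfolding lipconst_def
  by (intro SUP_cong) (auto intro!: arg_cong2[where f="(/)"])

section \<open>Borel measurable functionals on the space of Lipschitz functions\<close>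

lemma space_G_borel [simp]: "space G_borel = lipG"
  unfolding G_borel_def by (rule space_measure_of) (auto simp: G_open_def)

text \<open>\<open>G_borel\<close> is generated by the norm-open sets, so the preimage of an open
  set under a norm-continuous functional is itself a generator.\<close>

lemma lipnorm_lipschitz_borel_measurable:
  fixes h :: "(real \<Rightarrow> real) \<Rightarrow> real"
  assumes C: "C > 0"
    and h: "\<And>f g. f \<in> lipG \<Longrightarrow> g \<in> lipG \<Longrightarrow> \<bar>h g - h f\<bar> \<le> C * lipnorm (\<lambda>z. g z - f z)"
  shows "h \<in> borel_measurable G_borel"
proof (rule borel_measurableI)
  fix S :: "real set" assume S: "open S"
  have "G_open (h -` S \<inter> lipG)"
    unfolding G_open_def
  proof (intro conjI ballI)
    fix f assume f: "f \<in> h -` S \<inter> lipG"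
    with S obtain e where e: "e > 0" "\<And>y. dist y (h f) < e \<Longrightarrow> y \<in> S"
      unfolding open_dist by blast
    show "\<exists>e>0. \<forall>g\<in>lipG. lipnorm (\<lambda>z. g z - f z) < e \<longrightarrow> g \<in> h -` S \<inter> lipG"
    proof (intro exI[of _ "e / C"] conjI ballI impI)
      fix g assume g: "g \<in> lipG" "lipnorm (\<lambda>z. g z - f z) < e / C"
      then have "\<bar>h g - h f\<bar> < e"
        using h[of f g] f C by (auto simp: field_simps)
      then show "g \<in> h -` S \<inter> lipG" using e g by (auto simp: dist_real_def)
    qed (use e C in auto)
  qed auto
  then show "h -` S \<inter> space G_borel \<in> sets G_borel"
    unfolding space_G_borel unfolding G_borel_def
    by (subst sets_measure_of) (auto simp: G_open_def intro!: sigma_sets.Basic)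
qed

lemma lipconst_measurable: "lipconst \<in> borel_measurable G_borel"
proof (rule lipnorm_lipschitz_borel_measurable[of 1])
  fix f g :: "real \<Rightarrow> real" assume "f \<in> lipG" "g \<in> lipG"
  then show "\<bar>lipconst g - lipconst f\<bar> \<le> 1 * lipnorm (\<lambda>z. g z - f z)"
    using lipconst_le_diff[of f g] lipconst_le_diff[of g f] lipconst_minus[of g f]
    unfolding lipnorm_def by auto
qed simp

lemma eval_measurable: "(\<lambda>f. f z) \<in> borel_measurable G_borel"
proof (rule lipnorm_lipschitz_borel_measurable[of "1 + \<bar>z\<bar>"])
  fix f g :: "real \<Rightarrow> real" assume fg: "f \<in> lipG" "g \<in> lipG"
  let ?d = "\<lambda>z. g z - f z"
  have "\<bar>?d z - ?d 0\<bar> \<le> lipconst ?d * \<bar>z - 0\<bar>"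
    by (rule lipconst_bound[OF lipG_diff]) (use fg in auto)
  then have "\<bar>?d z\<bar> \<le> \<bar>?d 0\<bar> + lipconst ?d * \<bar>z\<bar>" by auto
  also have "\<dots> \<le> (1 + \<bar>z\<bar>) * lipnorm ?d"
    using lipconst_nonneg[OF lipG_diff[OF fg(2,1)]] unfolding lipnorm_def
    by (simp add: algebra_simps)
  finally show "\<bar>g z - f z\<bar> \<le> (1 + \<bar>z\<bar>) * lipnorm ?d" .
qed simp

section \<open>A moment of the Lipschitz constant below one\<close>

text \<open>Concavity of \<open>L powr s\<close> in \<open>L\<close>: the graph lies below its
  tangent \<open>1 + s * (L - 1)\<close> at 1, which is Young's inequality with weights
  \<open>s\<close> and \<open>1 - s\<close>.\<close>

lemma powr_quotient_nonneg:
  fixes L :: real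
  assumes "L \<ge> 0" "0 < s" "s \<le> 1"
  shows "0 \<le> (1 - L powr s) / s + L - 1"
proof -
  have "1 + s * (L - 1) \<ge> L powr s"
  proof -
    have "(1 + (L - 1)) powr s \<le> 1 + s * (L - 1)"
    proof (cases "L = 0")
      case False
      then have "L powr s * 1 powr (1 - s) \<le> s * L + (1 - s) * 1"
        using assms by (intro Youngs_inequality_0) auto
      then show ?thesis by (simp add: algebra_simps)
    qed (use assms in auto)
    then show ?thesis by simp
  qed
  then show ?thesis using assms by (simp add: field_simps)
qed


text \<open>Up to sign, the fraction is the difference quotient at 0 of
  \<open>\<lambda>s. L powr s\<close>, whose derivative there is \<open>ln L\<close>.\<close>

lemma powr_quotient_tendsto:
  fixes L :: real
  assumes "L > 0"
  shows "(\<lambda>n. (1 - L powr (1 / real (Suc n))) / (1 / real (Suc n)) + L - 1) \<longlonglongrightarrow> - ln L + L - 1"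
proof -
  have "((\<lambda>s. L powr s) has_real_derivative ln L * L powr 0) (at 0)"
    using assms by (auto intro!: derivative_eq_intros)
  then have "((\<lambda>s. (L powr s - 1) / s) \<longlongrightarrow> ln L) (at 0)"
    using assms by (simp add: has_field_derivative_iff)
  moreover have "filterlim (\<lambda>n. 1 / real (Suc n)) (at 0) sequentially"
    unfolding filterlim_at using LIMSEQ_Suc[OF lim_1_over_n] by (auto simp: always_eventually)
  ultimately have "(\<lambda>n. (L powr (1 / real (Suc n)) - 1) / (1 / real (Suc n))) \<longlonglongrightarrow> ln L"
    by (rule filterlim_compose)
  from tendsto_add[OF tendsto_minus[OF this] tendsto_const[of "L - 1"]]
  show ?thesis by (simp add: field_simps)
qed

text \<open>As \<open>s\<close> decreases to 0, \<open>(1 - L\<^sup>s) / s\<close> tends to \<open>- ln L\<close>; Fatou's lemma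
  applies after adding \<open>L - 1\<close>, which makes the quotients nonnegative.\<close>
lemma exists_contracting_moment:
  assumes "prob_space \<nu>" and sets: "sets \<nu> = sets G_borel"
    and EL: "(\<integral>\<^sup>+ f. ennreal (lipconst f) \<partial>\<nu>) < \<infinity>"
    and Elog: "exp_log_lip_neg \<nu>"
  obtains s where "0 < s" "s \<le> 1" "(\<integral>\<^sup>+ f. ennreal (lipconst f powr s) \<partial>\<nu>) < 1"
proof (rule ccontr)
  interpret prob_space \<nu> by fact
  note thesisI = that
  assume no: "\<not> thesis"
  have space: "space \<nu> = lipG" using sets_eq_imp_space_eq[OF sets] by simp
  have [measurable]: "lipconst \<in> borel_measurable \<nu>"
    using lipconst_measurable measurable_cong_sets[OF sets refl] by blast
  have L0: "lipconst f \<ge> 0" if "f \<in> space \<nu>" for f using that space lipconst_nonneg by auto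
  have ge: "1 \<le> (\<integral>\<^sup>+ f. ennreal (lipconst f powr s) \<partial>\<nu>)" if "0 < s" "s \<le> 1" for s
    using thesisI[OF that] no by (auto simp: not_less[symmetric])
  define s where "s n = 1 / real (Suc n)" for n
  have s: "0 < s n" "s n \<le> 1" for n by (auto simp: s_def)
  define \<psi> where "\<psi> n f = (1 - lipconst f powr s n) / s n + lipconst f - 1" for n f
  define I where "I = (\<integral>\<^sup>+ f. ennreal (lipconst f) \<partial>\<nu>)"
  define pos where "pos f = (if lipconst f = 0 then 0 else log_pos (lipconst f))" for f
  define neg where "neg f = log_neg (lipconst f)" for f
  have [measurable]: "\<psi> n \<in> borel_measurable \<nu>" for n unfolding \<psi>_def by measurable
  have [measurable]: "pos \<in> borel_measurable \<nu>" unfolding pos_def log_pos_def by measurable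
  have [measurable]: "neg \<in> borel_measurable \<nu>" unfolding neg_def log_neg_def by measurable
  \<comment> \<open>If all moments are at least 1, the terms \<open>1 / s n\<close> cancel and
    \<open>\<psi> n\<close> has mean at most E L - 1. Sums on both sides avoid the truncated
    subtraction of \<open>ennreal\<close>.\<close>
  have bound: "(\<integral>\<^sup>+ f. ennreal (\<psi> n f) \<partial>\<nu>) + 1 \<le> I" for n
  proof -
    have "(\<integral>\<^sup>+ f. ennreal (\<psi> n f) \<partial>\<nu>) + 1 + ennreal (1 / s n)
        \<le> (\<integral>\<^sup>+ f. ennreal (\<psi> n f) \<partial>\<nu>) + 1 + ennreal (1 / s n) * (\<integral>\<^sup>+ f. ennreal (lipconst f powr s n) \<partial>\<nu>)"
      using mult_left_mono[OF ge[OF s[of n]], of "ennreal (1 / s n)"] by (intro add_left_mono) auto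
    also have "\<dots> = (\<integral>\<^sup>+ f. ennreal (\<psi> n f) + 1 + ennreal (1 / s n) * ennreal (lipconst f powr s n) \<partial>\<nu>)"
      by (simp add: nn_integral_add nn_integral_cmult emeasure_space_1)
    also have "\<dots> = (\<integral>\<^sup>+ f. ennreal (lipconst f) + ennreal (1 / s n) \<partial>\<nu>)"
    proof (rule nn_integral_cong)
      fix f assume "f \<in> space \<nu>"
      note L = L0[OF this]
      have "0 \<le> \<psi> n f" unfolding \<psi>_def using powr_quotient_nonneg[OF L s] .
      then have "ennreal (\<psi> n f) + 1 + ennreal (1 / s n) * ennreal (lipconst f powr s n)
          = ennreal (\<psi> n f + 1 + 1 / s n * lipconst f powr s n)"
        using s[of n] by (simp flip: ennreal_mult' ennreal_plus ennreal_1)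
      also have "\<psi> n f + 1 + 1 / s n * lipconst f powr s n = lipconst f + 1 / s n"
        unfolding \<psi>_def using s[of n] by (simp add: field_simps)
      finally show "ennreal (\<psi> n f) + 1 + ennreal (1 / s n) * ennreal (lipconst f powr s n)
          = ennreal (lipconst f) + ennreal (1 / s n)"
        using L s[of n] by (simp add: ennreal_plus)
    qed
    also have "\<dots> = I + ennreal (1 / s n)"
      by (simp add: nn_integral_add emeasure_space_1 I_def)
    finally show ?thesis by (simp add: add_right_mono ennreal_add_left_cancel_le add.commute)
  qed
  define lim where "lim f = liminf (\<lambda>n. ennreal (\<psi> n f))" for f
  have [measurable]: "lim \<in> borel_measurable \<nu>" unfolding lim_def by measurable
  have "(\<integral>\<^sup>+ f. lim f \<partial>\<nu>) + 1 \<le> liminf (\<lambda>n. \<integral>\<^sup>+ f. ennreal (\<psi> n f) \<partial>\<nu>) + 1"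
    unfolding lim_def by (intro add_right_mono nn_integral_liminf) auto
  also have "\<dots> \<le> I"
  proof -
    have "liminf (\<lambda>n. \<integral>\<^sup>+ f. ennreal (\<psi> n f) \<partial>\<nu>) \<le> I - 1"
    proof (rule Liminf_le)
      show "\<forall>\<^sub>F n in sequentially. (\<integral>\<^sup>+ f. ennreal (\<psi> n f) \<partial>\<nu>) \<le> I - 1"
        using bound by (intro always_eventually allI) (simp add: ennreal_le_minus_iff)
    qed simp
    moreover have "1 \<le> I" using order.trans[OF add_increasing[OF zero_le order.refl] bound[of 0]] .
    ultimately have "liminf (\<lambda>n. \<integral>\<^sup>+ f. ennreal (\<psi> n f) \<partial>\<nu>) + 1 \<le> I - 1 + 1"
      by (intro add_right_mono)
    also have "\<dots> = I" using \<open>1 \<le> I\<close> by (simp add: diff_add_cancel_ennreal)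
    finally show ?thesis .
  qed
  finally have *: "(\<integral>\<^sup>+ f. lim f \<partial>\<nu>) + 1 \<le> I" .
  \<comment> \<open>For L > 0 both sides agree, since the negative part minus the positive part of
    the logarithm is - ln L. For L = 0, \<open>\<psi> n f\<close> equals \<open>n\<close>, so the
    right side is infinite.\<close>
  have pw: "neg f + ennreal (lipconst f) \<le> lim f + 1 + pos f" if f: "f \<in> space \<nu>" for f
  proof (cases "lipconst f = 0")
    case True
    have "\<psi> n f = real n" for n unfolding \<psi>_def s_def True by (simp add: field_simps)
    moreover have "(\<lambda>n. ennreal (real n)) \<longlonglongrightarrow> \<infinity>"
      by (simp add: ennreal_of_nat_eq_real_of_nat[symmetric] of_nat_tendsto_top_ennreal)
    ultimately have "lim f = \<infinity>" unfolding lim_def by (simp add: lim_imp_Liminf)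
    then show ?thesis by simp
  next
    case False
    with L0[OF f] have L: "lipconst f > 0" by simp
    have "(\<lambda>n. \<psi> n f) \<longlonglongrightarrow> - ln (lipconst f) + lipconst f - 1"
      unfolding \<psi>_def s_def by (rule powr_quotient_tendsto[OF L])
    then have "lim f = ennreal (- ln (lipconst f) + lipconst f - 1)"
      unfolding lim_def by (intro lim_imp_Liminf tendsto_ennrealI) auto
    moreover have "0 \<le> - ln (lipconst f) + lipconst f - 1" using ln_le_minus_one[OF L] by simp
    ultimately show ?thesis using L False
      by (auto simp: neg_def pos_def log_pos_def log_neg_def max_def simp flip: ennreal_plus ennreal_1)
  qed
  have "(\<integral>\<^sup>+ f. neg f \<partial>\<nu>) + I = (\<integral>\<^sup>+ f. neg f + ennreal (lipconst f) \<partial>\<nu>)"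
    by (simp add: nn_integral_add I_def)
  also have "\<dots> \<le> (\<integral>\<^sup>+ f. lim f + 1 + pos f \<partial>\<nu>)"
    by (intro nn_integral_mono pw)
  also have "\<dots> = (\<integral>\<^sup>+ f. lim f \<partial>\<nu>) + 1 + (\<integral>\<^sup>+ f. pos f \<partial>\<nu>)"
    by (simp add: nn_integral_add emeasure_space_1)
  also have "\<dots> \<le> I + (\<integral>\<^sup>+ f. pos f \<partial>\<nu>)"
    using * by (intro add_right_mono)
  \<comment> \<open>Finiteness of E L is what allows \<open>I\<close> to be cancelled.\<close>
  finally have "(\<integral>\<^sup>+ f. neg f \<partial>\<nu>) \<le> (\<integral>\<^sup>+ f. pos f \<partial>\<nu>)"
    using EL unfolding I_def[symmetric] by (auto simp: add.commute[of _ I] ennreal_add_left_cancel_le)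
  then show False using Elog unfolding exp_log_lip_neg_def pos_def neg_def by simp
qed


section \<open>Products over the points of a Poisson process\<close>

lemma poisson_process_prob_space: "poisson_process M P \<mu> \<Longrightarrow> prob_space M"
  unfolding poisson_process_def by blast

lemma poisson_process_AE_finite:
  assumes "poisson_process M P \<mu>" "A \<in> sets \<mu>" "emeasure \<mu> A < \<infinity>"
  shows "AE \<omega> in M. finite (P \<omega> \<inter> A)"
proof -
  have "\<forall>A\<in>sets \<mu>. emeasure \<mu> A < \<infinity> \<longrightarrow> (AE \<omega> in M. finite (P \<omega> \<inter> A))"
    using assms(1) unfolding poisson_process_def by simp
  with assms(2,3) show ?thesis by simp
qed

lemma poisson_process_count:
  assumes "poisson_process M P \<mu>" "A \<in> sets \<mu>" "emeasure \<mu> A < \<infinity>"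
  shows "measure M {\<omega>\<in>space M. card (P \<omega> \<inter> A) = k}
                   = (measure \<mu> A) ^ k / fact k * exp (- measure \<mu> A)"
  using assms unfolding poisson_process_def by blast

lemma poisson_process_indep:
  assumes "poisson_process M P \<mu>" "finite I" "\<And>i. i \<in> I \<Longrightarrow> A i \<in> sets \<mu>"
    "\<And>i. i \<in> I \<Longrightarrow> emeasure \<mu> (A i) < \<infinity>" "disjoint_family_on A I"
  shows "prob_space.indep_vars M (\<lambda>_. count_space (UNIV :: nat set))
           (\<lambda>i \<omega>. card (P \<omega> \<inter> A i)) (I :: nat set)"
proof -
  have "\<forall>(I::nat set) A. finite I \<longrightarrow> (\<forall>i\<in>I. A i \<in> sets \<mu> \<and> emeasure \<mu> (A i) < \<infinity>) \<longrightarrow>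
        disjoint_family_on A I \<longrightarrow>
        prob_space.indep_vars M (\<lambda>_. count_space (UNIV :: nat set))
           (\<lambda>i \<omega>. card (P \<omega> \<inter> A i)) I"
    using assms(1) unfolding poisson_process_def by (elim conjE)
  from this[rule_format, of I A] assms(2-5) show ?thesis by simp
qed

lemma poisson_process_count_measurable:
  assumes "poisson_process M P \<mu>" "A \<in> sets \<mu>" "emeasure \<mu> A < \<infinity>"
  shows "(\<lambda>\<omega>. card (P \<omega> \<inter> A)) \<in> measurable M (count_space UNIV)"
proof -
  interpret prob_space M using assms(1) by (rule poisson_process_prob_space)
  show ?thesis
    using poisson_process_indep[OF assms(1), of "{0}" "\<lambda>_. A"] assms
    by (auto simp: indep_vars_def disjoint_family_on_def)
qed

lemma poisson_process_pgf:
  assumes PP: "poisson_process M P \<mu>" and A: "A \<in> sets \<mu>" "emeasure \<mu> A < \<infinity>" and c: "c \<ge> 0"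
  shows "(\<integral>\<^sup>+ \<omega>. ennreal c ^ card (P \<omega> \<inter> A) \<partial>M) = ennreal (exp ((c - 1) * measure \<mu> A))"
proof -
  interpret prob_space M using PP by (rule poisson_process_prob_space)
  let ?l = "measure \<mu> A"
  let ?N = "\<lambda>\<omega>. card (P \<omega> \<inter> A)"
  have [measurable]: "?N \<in> measurable M (count_space UNIV)"
    by (rule poisson_process_count_measurable[OF PP A])
  have "(\<integral>\<^sup>+ \<omega>. ennreal c ^ ?N \<omega> \<partial>M)
      = (\<integral>\<^sup>+ \<omega>. (\<Sum>k. ennreal (c ^ k) * indicator {\<omega>\<in>space M. ?N \<omega> = k} \<omega>) \<partial>M)"
  proof (rule nn_integral_cong)
    fix \<omega> assume "\<omega> \<in> space M"
    then have "(\<Sum>k. ennreal (c ^ k) * indicator {\<omega>\<in>space M. ?N \<omega> = k} \<omega>)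
        = (\<Sum>k\<in>{?N \<omega>}. ennreal (c ^ k) * indicator {\<omega>\<in>space M. ?N \<omega> = k} \<omega>)"
      by (intro suminf_finite) (auto simp: indicator_def)
    also have "\<dots> = ennreal c ^ ?N \<omega>" using \<open>\<omega> \<in> space M\<close> c by (simp add: ennreal_power)
    finally show "ennreal c ^ ?N \<omega> = (\<Sum>k. ennreal (c ^ k) * indicator {\<omega>\<in>space M. ?N \<omega> = k} \<omega>)" ..
  qed
  also have "\<dots> = (\<Sum>k. ennreal (c ^ k) * emeasure M {\<omega>\<in>space M. ?N \<omega> = k})"
    by (subst nn_integral_suminf) (auto simp: nn_integral_cmult)
  also have "\<dots> = (\<Sum>k. ennreal (exp (- ?l) * ((c * ?l) ^ k /\<^sub>R fact k)))"
  proof (intro suminf_cong)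
    fix k
    have "emeasure M {\<omega>\<in>space M. ?N \<omega> = k} = ennreal (?l ^ k / fact k * exp (- ?l))"
      using poisson_process_count[OF PP A, of k] by (simp add: emeasure_eq_measure)
    moreover have "c ^ k * (?l ^ k / fact k * exp (- ?l)) = exp (- ?l) * ((c * ?l) ^ k /\<^sub>R fact k)"
      by (simp add: field_simps power_mult_distrib)
    ultimately show "ennreal (c ^ k) * emeasure M {\<omega>\<in>space M. ?N \<omega> = k} = ennreal (exp (- ?l) * ((c * ?l) ^ k /\<^sub>R fact k))"
      using c by (metis ennreal_mult' zero_le_power)
  qed
  also have "\<dots> = ennreal (exp (- ?l) * exp (c * ?l))"
    using c by (intro suminf_ennreal_eq sums_mult exp_converges) auto
  also have "exp (- ?l) * exp (c * ?l) = exp ((c - 1) * ?l)"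
    by (simp add: algebra_simps flip: exp_add)
  finally show ?thesis .
qed

text \<open>Since \<open>exp (- l) \<ge> 1 - l\<close>, the probability is at most
  \<open>1 - (1 - l) * (1 + l)\<close>. The quadratic order matters: over n cells of measure of
  order 1/n the bounds sum to order 1/n.\<close>

lemma poisson_process_card_ge_2:
  assumes PP: "poisson_process M P \<mu>" and A: "A \<in> sets \<mu>" "emeasure \<mu> A < \<infinity>"
  shows "measure M {\<omega>\<in>space M. 2 \<le> card (P \<omega> \<inter> A)} \<le> (measure \<mu> A)\<^sup>2"
proof -
  interpret prob_space M using PP by (rule poisson_process_prob_space)
  let ?l = "measure \<mu> A"
  let ?N = "\<lambda>\<omega>. card (P \<omega> \<inter> A)"
  have [measurable]: "?N \<in> measurable M (count_space UNIV)"
    by (rule poisson_process_count_measurable[OF PP A])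
  have "prob {\<omega>\<in>space M. ?N \<omega> = 0} + prob {\<omega>\<in>space M. ?N \<omega> = 1}
      = prob ({\<omega>\<in>space M. ?N \<omega> = 0} \<union> {\<omega>\<in>space M. ?N \<omega> = 1})"
    by (rule finite_measure_Union[symmetric]) auto
  also have "{\<omega>\<in>space M. ?N \<omega> = 0} \<union> {\<omega>\<in>space M. ?N \<omega> = 1} = space M - {\<omega>\<in>space M. 2 \<le> ?N \<omega>}"
    by auto
  also have "prob \<dots> = 1 - prob {\<omega>\<in>space M. 2 \<le> ?N \<omega>}"
    by (rule prob_compl) measurable
  finally have "prob {\<omega>\<in>space M. 2 \<le> ?N \<omega>} = 1 - exp (- ?l) * (1 + ?l)"
    using poisson_process_count[OF PP A, of 0] poisson_process_count[OF PP A, of 1]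
    by (simp add: algebra_simps)
  also have "\<dots> \<le> 1 - (1 + - ?l) * (1 + ?l)"
    using exp_ge_add_one_self[of "- ?l"] by (intro diff_left_mono mult_right_mono) auto
  also have "\<dots> = ?l\<^sup>2" by (simp add: algebra_simps power2_eq_square)
  finally show ?thesis .
qed

text \<open>The exponential formula, with the integral of \<open>F - 1\<close> in the exponent, for
  simple \<open>F\<close>. On each level set of \<open>F\<close> the product is a power with a
  Poisson exponent; counts on disjoint level sets are independent, so generating functions
  multiply.\<close>

lemma poisson_process_simple_product:
  assumes PP: "poisson_process M P \<mu>" and A: "A \<in> sets \<mu>" "emeasure \<mu> A < \<infinity>"
    and F: "simple_function \<mu> F" "\<And>x. F x < (\<top>::ennreal)"
    and K: "K \<ge> 0" "(\<integral>\<^sup>+ x\<in>A. F x \<partial>\<mu>) \<le> ennreal K"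
  obtains Z where "Z \<in> borel_measurable M"
    "AE \<omega> in M. Z \<omega> = (\<Prod>p\<in>P \<omega> \<inter> A. F p)"
    "(\<integral>\<^sup>+ \<omega>. Z \<omega> \<partial>M) \<le> ennreal (exp (K - measure \<mu> A))"
proof -
  interpret prob_space M using PP by (rule poisson_process_prob_space)
  define V where "V = F ` space \<mu>"
  have "finite V" using F(1) unfolding V_def simple_function_def by blast
  \<comment> \<open>The values are enumerated because independence of the counts is stated for index
    sets of naturals.\<close>
  then obtain h where h: "bij_betw h {0..<card V} V" using ex_bij_betw_nat_finite by blast
  define I where "I = {0..<card V}"
  define B where "B i = A \<inter> (F -` {h i} \<inter> space \<mu>)" for i
  have B[measurable]: "B i \<in> sets \<mu>" if "i \<in> I" for i
  proof -
    have "h i \<in> F ` space \<mu>" using bij_betwE[OF h] that unfolding I_def V_def by auto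
    then have "F -` {h i} \<inter> space \<mu> \<in> sets \<mu>" using F(1) unfolding simple_function_def by blast
    then show ?thesis using A(1) unfolding B_def by (rule sets.Int[rotated])
  qed
  have Bf: "emeasure \<mu> (B i) < \<infinity>" for i
  proof -
    have "emeasure \<mu> (B i) \<le> emeasure \<mu> A" using A(1) unfolding B_def by (intro emeasure_mono) auto
    also note A(2)
    finally show ?thesis .
  qed
  have disj: "disjoint_family_on B I"
    using h unfolding disjoint_family_on_def B_def I_def bij_betw_def inj_on_def by auto
  have UnB: "(\<Union>i\<in>I. B i) = A"
  proof -
    have "\<exists>i\<in>I. F x = h i" if "x \<in> A" for x
    proof -
      have "F x \<in> h ` I" using h that sets.sets_into_space[OF A(1)] unfolding I_def bij_betw_def V_def by auto
      then show ?thesis by blast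
    qed
    then show ?thesis using sets.sets_into_space[OF A(1)] unfolding B_def by auto
  qed
  have finI: "finite I" unfolding I_def by simp
  define c where "c i = enn2real (h i)" for i
  have hc: "h i = ennreal (c i)" if "i \<in> I" for i
  proof -
    have "h i \<in> V" using bij_betwE[OF h] that I_def by auto
    then have "h i < \<top>" unfolding V_def using F(2) by auto
    then show ?thesis unfolding c_def by simp
  qed
  have c0: "c i \<ge> 0" for i unfolding c_def by simp
  define Z where "Z \<omega> = (\<Prod>i\<in>I. ennreal (c i) ^ card (P \<omega> \<inter> B i))" for \<omega>
  have N[measurable]: "(\<lambda>\<omega>. card (P \<omega> \<inter> B i)) \<in> measurable M (count_space UNIV)" if "i \<in> I" for i
    by (rule poisson_process_count_measurable[OF PP B[OF that] Bf])
  have [measurable]: "(\<lambda>\<omega>. ennreal (c i) ^ card (P \<omega> \<inter> B i)) \<in> borel_measurable M" if "i \<in> I" for i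
    using measurable_compose[OF N[OF that], of "\<lambda>k. ennreal (c i) ^ k" borel] by simp
  have Zm: "Z \<in> borel_measurable M" unfolding Z_def by measurable
  have mB: "(\<Sum>i\<in>I. measure \<mu> (B i)) = measure \<mu> A"
    unfolding UnB[symmetric] using disj finI Bf B
    by (intro measure_finite_Union[symmetric]) (auto simp: less_top)
  have "(\<Sum>i\<in>I. ennreal (c i * measure \<mu> (B i))) = (\<Sum>i\<in>I. \<integral>\<^sup>+ x\<in>B i. F x \<partial>\<mu>)"
  proof (rule sum.cong)
    fix i assume i: "i \<in> I"
    have "(\<integral>\<^sup>+ x\<in>B i. F x \<partial>\<mu>) = (\<integral>\<^sup>+ x. ennreal (c i) * indicator (B i) x \<partial>\<mu>)"
      by (intro nn_integral_cong) (auto simp: B_def hc[OF i] indicator_def)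
    also have "\<dots> = ennreal (c i) * emeasure \<mu> (B i)" using B[OF i] by (simp add: nn_integral_cmult)
    finally show "ennreal (c i * measure \<mu> (B i)) = (\<integral>\<^sup>+ x\<in>B i. F x \<partial>\<mu>)"
      using Bf[of i] c0 by (simp add: ennreal_mult emeasure_eq_ennreal_measure less_top)
  qed simp
  also have "\<dots> = (\<integral>\<^sup>+ x. (\<Sum>i\<in>I. F x * indicator (B i) x) \<partial>\<mu>)"
    using borel_measurable_simple_function[OF F(1)] B by (intro nn_integral_sum[symmetric]) auto
  also have "\<dots> = (\<integral>\<^sup>+ x\<in>A. F x \<partial>\<mu>)"
    unfolding UnB[symmetric] using disj finI
    by (intro nn_integral_cong) (simp add: indicator_UN_disjoint sum_distrib_left)
  finally have "(\<Sum>i\<in>I. ennreal (c i * measure \<mu> (B i))) \<le> ennreal K" using K(2) by simp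
  then have sumK: "(\<Sum>i\<in>I. c i * measure \<mu> (B i)) \<le> K"
    using c0 K(1) by (simp add: sum_ennreal)
  have "indep_vars (\<lambda>_. borel) (\<lambda>i \<omega>. ennreal (c i) ^ card (P \<omega> \<inter> B i)) I"
    by (rule indep_vars_compose2[OF poisson_process_indep[OF PP finI B Bf disj]]) auto
  then have "(\<integral>\<^sup>+ \<omega>. Z \<omega> \<partial>M) = (\<Prod>i\<in>I. \<integral>\<^sup>+ \<omega>. ennreal (c i) ^ card (P \<omega> \<inter> B i) \<partial>M)"
    unfolding Z_def by (intro indep_vars_nn_integral finI) auto
  also have "\<dots> = (\<Prod>i\<in>I. ennreal (exp ((c i - 1) * measure \<mu> (B i))))"
    by (intro prod.cong refl poisson_process_pgf[OF PP B Bf c0])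
  also have "\<dots> = ennreal (exp (\<Sum>i\<in>I. (c i - 1) * measure \<mu> (B i)))"
    by (simp add: prod_ennreal exp_sum finI)
  also have "\<dots> \<le> ennreal (exp (K - measure \<mu> A))"
    using sumK mB by (intro ennreal_leI) (simp add: algebra_simps sum_subtractf)
  finally have EZ: "(\<integral>\<^sup>+ \<omega>. Z \<omega> \<partial>M) \<le> ennreal (exp (K - measure \<mu> A))" .
  \<comment> \<open>If \<open>P \<omega> \<inter> A\<close> is infinite, \<open>prod\<close> and
    \<open>card\<close> take default values that need not match.\<close>
  have "AE \<omega> in M. Z \<omega> = (\<Prod>p\<in>P \<omega> \<inter> A. F p)"
    using poisson_process_AE_finite[OF PP A]
  proof eventually_elim
    fix \<omega> assume fin: "finite (P \<omega> \<inter> A)"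
    have sub: "P \<omega> \<inter> A \<subseteq> space \<mu>" using sets.sets_into_space[OF A(1)] by auto
    have "(\<Prod>p\<in>P \<omega> \<inter> A. F p) = (\<Prod>v\<in>V. \<Prod>p\<in>{p\<in>P \<omega> \<inter> A. F p = v}. F p)"
      using fin \<open>finite V\<close> sub by (intro prod.group[symmetric]) (auto simp: V_def)
    also have "\<dots> = (\<Prod>i\<in>I. \<Prod>p\<in>{p\<in>P \<omega> \<inter> A. F p = h i}. F p)"
      using h unfolding I_def by (intro prod.reindex_bij_betw[symmetric])
    also have "\<dots> = Z \<omega>"
      unfolding Z_def
    proof (rule prod.cong)
      fix i assume i: "i \<in> I"
      have "{p\<in>P \<omega> \<inter> A. F p = h i} = P \<omega> \<inter> B i" using sub unfolding B_def by auto
      moreover have "(\<Prod>p\<in>P \<omega> \<inter> B i. F p) = (\<Prod>p\<in>P \<omega> \<inter> B i. ennreal (c i))"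
        by (rule prod.cong) (auto simp: B_def hc[OF i])
      ultimately show "(\<Prod>p\<in>{p\<in>P \<omega> \<inter> A. F p = h i}. F p) = ennreal (c i) ^ card (P \<omega> \<inter> B i)"
        by simp
    qed simp
    finally show "Z \<omega> = (\<Prod>p\<in>P \<omega> \<inter> A. F p)" ..
  qed
  with Zm EZ that show thesis by blast
qed

text \<open>Multiplication in \<open>ennreal\<close> is discontinuous where 0 meets \<infinity>; the
  finite limits \<open>ennreal (g p)\<close> exclude this.\<close>

lemma tendsto_prod_ennreal:
  fixes F :: "nat \<Rightarrow> 'b \<Rightarrow> ennreal"
  assumes "finite S" "\<And>p. p \<in> S \<Longrightarrow> (\<lambda>n. F n p) \<longlonglongrightarrow> ennreal (g p)"
  shows "(\<lambda>n. \<Prod>p\<in>S. F n p) \<longlonglongrightarrow> (\<Prod>p\<in>S. ennreal (g p))"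
  using assms
proof (induction S)
  case (insert p S)
  have "(\<Prod>p\<in>S. ennreal (g p)) \<noteq> \<top>"
    by (simp add: ennreal_prod_eq_top)
  then show ?case using insert by (auto intro!: tendsto_mult_ennreal)
qed simp

text \<open>The product itself need not be measurable: it agrees with a measurable function only
  outside a null set, since \<open>P \<omega> \<inter> A\<close> is only almost surely finite.\<close>
lemma poisson_process_product_bound:
  fixes g :: "'b \<Rightarrow> real"
  assumes PP: "poisson_process M P \<mu>" and A: "A \<in> sets \<mu>" "emeasure \<mu> A < \<infinity>"
    and g: "g \<in> borel_measurable \<mu>"
    and K: "K \<ge> 0" "(\<integral>\<^sup>+ x\<in>A. ennreal (g x) \<partial>\<mu>) \<le> ennreal K"
  obtains Z where "Z \<in> borel_measurable M"
    "AE \<omega> in M. (\<Prod>p\<in>P \<omega> \<inter> A. ennreal (g p)) = Z \<omega>"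
    "(\<integral>\<^sup>+ \<omega>. Z \<omega> \<partial>M) \<le> ennreal (exp (K - measure \<mu> A))"
proof -
  obtain F where F: "\<And>n. simple_function \<mu> (F n)" "incseq F" "\<And>n x. F n x < (\<top>::ennreal)"
    "\<And>x. (SUP n. F n x) = ennreal (g x)"
    using borel_measurable_implies_simple_function_sequence'[of "\<lambda>x. ennreal (g x)" \<mu>] g by auto
  have "\<exists>Z. Z \<in> borel_measurable M \<and> (AE \<omega> in M. Z \<omega> = (\<Prod>p\<in>P \<omega> \<inter> A. F n p)) \<and>
      (\<integral>\<^sup>+ \<omega>. Z \<omega> \<partial>M) \<le> ennreal (exp (K - measure \<mu> A))" for n
  proof -
    have "(\<integral>\<^sup>+ x\<in>A. F n x \<partial>\<mu>) \<le> (\<integral>\<^sup>+ x\<in>A. ennreal (g x) \<partial>\<mu>)"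
      unfolding F(4)[symmetric] by (intro nn_integral_mono mult_right_mono SUP_upper) auto
    also note K(2)
    finally show ?thesis
      by (rule poisson_process_simple_product[OF PP A F(1,3) K(1)]) blast
  qed
  then obtain Y where Y: "\<And>n. Y n \<in> borel_measurable M"
      "\<And>n. AE \<omega> in M. Y n \<omega> = (\<Prod>p\<in>P \<omega> \<inter> A. F n p)"
      "\<And>n. (\<integral>\<^sup>+ \<omega>. Y n \<omega> \<partial>M) \<le> ennreal (exp (K - measure \<mu> A))"
    by metis
  have "AE \<omega> in M. \<forall>n. Y n \<omega> = (\<Prod>p\<in>P \<omega> \<inter> A. F n p)" using Y(2) by (simp add: AE_all_countable)
  \<comment> \<open>The \<open>liminf\<close> is measurable and defined everywhere; on the almost
    sure event it is a genuine limit, and Fatou's lemma transfers the bound on the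
    expectation.\<close>
  with poisson_process_AE_finite[OF PP A]
  have "AE \<omega> in M. (\<Prod>p\<in>P \<omega> \<inter> A. ennreal (g p)) = liminf (\<lambda>n. Y n \<omega>)"
  proof eventually_elim
    fix \<omega> assume fin: "finite (P \<omega> \<inter> A)" and eq: "\<forall>n. Y n \<omega> = (\<Prod>p\<in>P \<omega> \<inter> A. F n p)"
    have "(\<lambda>n. F n p) \<longlonglongrightarrow> ennreal (g p)" for p
      unfolding F(4)[symmetric] using F(2) by (intro LIMSEQ_SUP) (auto simp: incseq_def le_fun_def)
    then have "(\<lambda>n. \<Prod>p\<in>P \<omega> \<inter> A. F n p) \<longlonglongrightarrow> (\<Prod>p\<in>P \<omega> \<inter> A. ennreal (g p))"
      by (intro tendsto_prod_ennreal fin)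
    then show "(\<Prod>p\<in>P \<omega> \<inter> A. ennreal (g p)) = liminf (\<lambda>n. Y n \<omega>)"
      using eq by (simp add: lim_imp_Liminf)
  qed
  moreover have "(\<integral>\<^sup>+ \<omega>. liminf (\<lambda>n. Y n \<omega>) \<partial>M) \<le> ennreal (exp (K - measure \<mu> A))"
  proof -
    have "(\<integral>\<^sup>+ \<omega>. liminf (\<lambda>n. Y n \<omega>) \<partial>M) \<le> liminf (\<lambda>n. \<integral>\<^sup>+ \<omega>. Y n \<omega> \<partial>M)"
      by (rule nn_integral_liminf[OF Y(1)])
    also have "\<dots> \<le> ennreal (exp (K - measure \<mu> A))"
      using Y(3) by (intro Liminf_le) auto
    finally show ?thesis .
  qed
  moreover have "(\<lambda>\<omega>. liminf (\<lambda>n. Y n \<omega>)) \<in> borel_measurable M" using Y(1) by measurable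
  ultimately show thesis using that by blast
qed


section \<open>Variation of a finite composition\<close>

text \<open>Partitions are infinite monotone sequences that need not touch the endpoints. This class
  is stable under clipping, and the property passes to subintervals without adjusting
  endpoints.\<close>

definition bvar :: "(real \<Rightarrow> real) \<Rightarrow> real \<Rightarrow> real \<Rightarrow> bool" where
  "bvar g a b \<longleftrightarrow> (\<exists>C. \<forall>u n. mono u \<longrightarrow> range u \<subseteq> {a..b} \<longrightarrow>
     (\<Sum>i<(n::nat). \<bar>g (u (Suc i)) - g (u i)\<bar>) \<le> C)"

lemma bvar_total_variation:
  assumes "bvar g a b"
  shows "total_variation g a b < \<infinity>"
proof -
  obtain C where C: "\<And>u n. mono u \<Longrightarrow> range u \<subseteq> {a..b} \<Longrightarrow>
      (\<Sum>i<(n::nat). \<bar>g (u (Suc i)) - g (u i)\<bar>) \<le> C"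
    using assms unfolding bvar_def by blast
  have "total_variation g a b \<le> ereal C"
    unfolding total_variation_def
  proof (rule SUP_least, clarify)
    fix n and x :: "nat \<Rightarrow> real"
    assume x: "a = x 0" "b = x n" "\<forall>i<n. x i \<le> x (Suc i)"
    \<comment> \<open>The finite partition is frozen at its last point, which adds only zero
      increments.\<close>
    define u where "u i = x (min i n)" for i
    have "u i \<le> u (Suc i)" for i
      using x(3) by (cases "i < n") (auto simp: u_def)
    then have mono: "mono u" by (rule mono_iff_le_Suc[THEN iffD2, rule_format])
    have "u 0 \<le> u i" "u i \<le> u n" for i
      using monoD[OF mono, of 0 i] monoD[OF mono, of i n] by (cases "i \<le> n"; simp add: u_def)+
    then have "range u \<subseteq> {x 0..x n}" by (auto simp: u_def)
    from C[OF mono, of n] this x have "(\<Sum>i<n. \<bar>g (u (Suc i)) - g (u i)\<bar>) \<le> C" by auto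
    also have "(\<Sum>i<n. \<bar>g (u (Suc i)) - g (u i)\<bar>) = (\<Sum>i<n. \<bar>g (x (Suc i)) - g (x i)\<bar>)"
      by (rule sum.cong) (auto simp: u_def)
    finally show "ereal (\<Sum>i<n. \<bar>g (x (Suc i)) - g (x i)\<bar>) \<le> ereal C" by simp
  qed
  also have "\<dots> < \<infinity>" by simp
  finally show ?thesis .
qed

lemma bvar_subinterval:
  assumes "bvar g a b" "a \<le> c" "d \<le> b"
  shows "bvar g c d"
proof -
  have "{c..d} \<subseteq> {a..b}" using assms by auto
  with assms(1) show ?thesis unfolding bvar_def by (meson order.trans)
qed

text \<open>Clipping a partition at \<open>b\<close> from above and from below splits it into partitions of the two
  pieces.\<close>
lemma bvar_concat:
  assumes "bvar g a b" "bvar g b c"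
  shows "bvar g a c"
proof -
  obtain C1 where C1: "\<And>u n. mono u \<Longrightarrow> range u \<subseteq> {a..b} \<Longrightarrow>
      (\<Sum>i<(n::nat). \<bar>g (u (Suc i)) - g (u i)\<bar>) \<le> C1"
    using assms(1) unfolding bvar_def by blast
  obtain C2 where C2: "\<And>u n. mono u \<Longrightarrow> range u \<subseteq> {b..c} \<Longrightarrow>
      (\<Sum>i<(n::nat). \<bar>g (u (Suc i)) - g (u i)\<bar>) \<le> C2"
    using assms(2) unfolding bvar_def by blast
  consider "c \<le> b" | "b \<le> a" | "a \<le> b" "b \<le> c" by linarith
  then show ?thesis
  proof cases
    case 1 then show ?thesis using bvar_subinterval[OF assms(1)] by simp
  next
    case 2 then show ?thesis using bvar_subinterval[OF assms(2)] by simp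
  next
    case 3
    have "(\<Sum>i<n. \<bar>g (u (Suc i)) - g (u i)\<bar>) \<le> C1 + C2"
      if u: "mono u" "range u \<subseteq> {a..c}" for u and n :: nat
    proof -
      have r: "a \<le> u i" "u i \<le> c" for i using u(2) by (auto simp: subset_eq)
      have "(\<Sum>i<n. \<bar>g (u (Suc i)) - g (u i)\<bar>)
          \<le> (\<Sum>i<n. \<bar>g (min (u (Suc i)) b) - g (min (u i) b)\<bar> + \<bar>g (max (u (Suc i)) b) - g (max (u i) b)\<bar>)"
      proof (rule sum_mono)
        fix i
        have "u i \<le> u (Suc i)" using u(1) by (simp add: monoD)
        then show "\<bar>g (u (Suc i)) - g (u i)\<bar>
          \<le> \<bar>g (min (u (Suc i)) b) - g (min (u i) b)\<bar> + \<bar>g (max (u (Suc i)) b) - g (max (u i) b)\<bar>"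
          by (auto simp: min_def max_def)
      qed
      also have "\<dots> \<le> C1 + C2"
        unfolding sum.distrib
      proof (rule add_mono)
        show "(\<Sum>i<n. \<bar>g (min (u (Suc i)) b) - g (min (u i) b)\<bar>) \<le> C1"
          using u(1) r 3 by (intro C1[of "\<lambda>i. min (u i) b"]) (auto simp: monoD intro!: monoI min.mono)
        show "(\<Sum>i<n. \<bar>g (max (u (Suc i)) b) - g (max (u i) b)\<bar>) \<le> C2"
          using u(1) r 3 by (intro C2[of "\<lambda>i. max (u i) b"]) (auto simp: monoD intro!: monoI max.mono)
      qed
      finally show ?thesis .
    qed
    then show ?thesis unfolding bvar_def by blast
  qed
qed

text \<open>A point above level \<open>x\<close> acts as the identity instead of being left out, so
  one list of points serves all \<open>x\<close> at once and compositions for different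
  \<open>x\<close> can be compared map by map.\<close>

definition act :: "real \<Rightarrow> point \<Rightarrow> real \<Rightarrow> real" where
  "act x p w = (if fst (snd p) \<le> x then snd (snd p) w else w)"

definition gain :: "real \<Rightarrow> point \<Rightarrow> real" where
  "gain a p = (if fst (snd p) \<le> a then lipconst (snd (snd p)) else 3 * max 1 (lipconst (snd (snd p))))"

definition displ :: "real \<Rightarrow> point \<Rightarrow> real" where
  "displ z p = \<bar>snd (snd p) z - z\<bar>"

text \<open>\<open>energy\<close> bounds the variation over \<open>[a, b]\<close> plus the distance from \<open>z\<close> of a finite
  composition. Prepending a map with \<open>y \<le> a\<close> multiplies both by at most \<open>L\<close>. For
  \<open>a < y \<le> b\<close> it also creates a jump, whose size is controlled by the distance from \<open>z\<close>.\<close>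
definition energy :: "real \<Rightarrow> real \<Rightarrow> point list \<Rightarrow> real" where
  "energy a z ps = foldr (\<lambda>p e. 2 * displ z p + gain a p * e) ps 0"

lemma energy_simps [simp]:
  "energy a z [] = 0"
  "energy a z (p # ps) = 2 * displ z p + gain a p * energy a z ps"
  by (simp_all add: energy_def)

lemma displ_nonneg [simp]: "0 \<le> displ z p" by (simp add: displ_def)

lemma gain_nonneg: "snd (snd p) \<in> lipG \<Longrightarrow> 0 \<le> gain a p"
  by (auto simp: gain_def lipconst_nonneg)

lemma energy_nonneg: "(\<And>p. p \<in> set ps \<Longrightarrow> snd (snd p) \<in> lipG) \<Longrightarrow> 0 \<le> energy a z ps"
  by (induction ps) (auto simp: gain_nonneg)

text \<open>Each map acts on the energy of its tail as an affine function with slope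
  \<open>gain a p\<close>, and slopes multiply under composition.\<close>

lemma energy_append:
  "energy a z (ps @ qs) = energy a z ps + prod_list (map (gain a) ps) * energy a z qs"
  by (induction ps) (auto simp: algebra_simps)

text \<open>The exponential formula handles products over points, whereas the energy is a sum;
  within one time slot this crude conversion suffices.\<close>

lemma energy_le_prod:
  assumes "\<And>p. p \<in> set ps \<Longrightarrow> snd (snd p) \<in> lipG"
  shows "energy a z ps \<le> prod_list (map (\<lambda>p. 1 + gain a p + 2 * displ z p) ps)"
proof -
  \<comment> \<open>The stronger bound with \<open>- 1\<close> supplies \<open>1 \<le> ?Q\<close>,
    because energies are nonnegative.\<close>
  have "energy a z ps \<le> prod_list (map (\<lambda>p. 1 + gain a p + 2 * displ z p) ps) - 1"
    using assms
  proof (induction ps)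
    case (Cons p ps)
    let ?Q = "prod_list (map (\<lambda>p. 1 + gain a p + 2 * displ z p) ps)"
    have IH: "energy a z ps \<le> ?Q - 1" using Cons by auto
    have e0: "0 \<le> energy a z ps" using Cons by (intro energy_nonneg) auto
    have g: "0 \<le> gain a p" using Cons.prems[of p] by (simp add: gain_nonneg)
    have "gain a p * energy a z ps \<le> gain a p * ?Q" using IH g by (intro mult_left_mono) auto
    moreover have "2 * displ z p * 1 \<le> 2 * displ z p * ?Q" using IH e0 by (intro mult_left_mono) auto
    ultimately show ?case using IH e0 by (simp add: algebra_simps)
  qed simp
  then show ?thesis by simp
qed

text \<open>Later points act innermost, so a longer time horizon only changes the value to which the
  earlier composition is applied.\<close>

lemma foldr_act_contract:
  assumes "\<And>p. p \<in> set ps \<Longrightarrow> snd (snd p) \<in> lipG" "a \<le> x"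
  shows "\<bar>foldr (act x) ps v - foldr (act x) ps w\<bar> \<le> prod_list (map (gain a) ps) * \<bar>v - w\<bar>"
  using assms(1)
proof (induction ps)
  case (Cons p ps)
  let ?v = "foldr (act x) ps v" and ?w = "foldr (act x) ps w" and ?L = "lipconst (snd (snd p))"
  have p: "snd (snd p) \<in> lipG" using Cons by auto
  have "\<bar>act x p ?v - act x p ?w\<bar> \<le> gain a p * \<bar>?v - ?w\<bar>"
  proof (cases "fst (snd p) \<le> a")
    case True
    then show ?thesis using lipconst_bound[OF p] assms(2) by (auto simp: act_def gain_def)
  next
    case False
    have "?L * \<bar>?v - ?w\<bar> \<le> (3 * max 1 ?L) * \<bar>?v - ?w\<bar>"
      "1 * \<bar>?v - ?w\<bar> \<le> (3 * max 1 ?L) * \<bar>?v - ?w\<bar>"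
      by (intro mult_right_mono; auto)+
    with False show ?thesis using lipconst_bound[OF p, of ?v ?w] by (auto simp: act_def gain_def)
  qed
  also have "\<dots> \<le> gain a p * (prod_list (map (gain a) ps) * \<bar>v - w\<bar>)"
    using Cons by (intro mult_left_mono gain_nonneg p) auto
  finally show ?case by (simp add: mult.assoc)
qed simp

text \<open>A monotone sequence passes the level \<open>y\<close> at most once. The induction
  records that the count is still 0 while \<open>u n < y\<close>.\<close>

lemma mono_jump_count:
  assumes "mono (u :: nat \<Rightarrow> real)"
  shows "(\<Sum>i<n. if u i < y \<and> y \<le> u (Suc i) then 1 else 0 :: real) \<le> 1"
proof -
  have "(\<Sum>i<n. if u i < y \<and> y \<le> u (Suc i) then 1 else 0 :: real) \<le> (if y \<le> u n then 1 else 0)"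
  proof (induction n)
    case (Suc n)
    have "u n \<le> u (Suc n)" using assms by (simp add: monoD)
    with Suc show ?case by (auto split: if_splits)
  qed simp
  then show ?thesis by (auto split: if_splits)
qed

text \<open>Variation and distance are bounded jointly, and for every \<open>x\<close>, because a
  new jump is paid for by the distance: the induction hypothesis gives
  \<open>\<bar>h v - z\<bar> \<le> e - V\<close> at whichever \<open>v\<close> the jump
  occurs.\<close>

lemma variation_le_energy:
  assumes "\<And>p. p \<in> set ps \<Longrightarrow> snd (snd p) \<in> lipG"
    and u: "mono u" "range u \<subseteq> {a..b}"
    and x: "a \<le> x" "x \<le> b"
  shows "(\<Sum>i<n. \<bar>foldr (act (u (Suc i))) ps z - foldr (act (u i)) ps z\<bar>)
      + \<bar>foldr (act x) ps z - z\<bar> \<le> energy a z ps"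
  using assms(1) x
proof (induction ps arbitrary: x)
  case Nil
  then show ?case by simp
next
  case (Cons p ps)
  obtain t y f where p: "p = (t, y, f)" by (cases p)
  define h where "h v = foldr (act v) ps z" for v
  define V where "V = (\<Sum>i<n. \<bar>h (u (Suc i)) - h (u i)\<bar>)"
  define e where "e = energy a z ps"
  define L where "L = lipconst f"
  define c where "c = \<bar>f z - z\<bar>"
  have f: "f \<in> lipG" using Cons.prems(1)[of p] p by simp
  have L0: "0 \<le> L" unfolding L_def using f by (rule lipconst_nonneg)
  have Lip: "\<bar>f v - f w\<bar> \<le> L * \<bar>v - w\<bar>" for v w unfolding L_def by (rule lipconst_bound[OF f])
  have IH: "V + \<bar>h v - z\<bar> \<le> e" if "a \<le> v" "v \<le> b" for v
    unfolding V_def h_def e_def using Cons that by auto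
  have ua: "a \<le> u i" "u i \<le> b" for i using u(2) by (auto simp: subset_eq)
  have V0: "0 \<le> V" unfolding V_def by (intro sum_nonneg) auto
  have act: "act v p w = (if y \<le> v then f w else w)" for v w by (simp add: act_def p)
  have fz: "\<bar>f v - z\<bar> \<le> L * \<bar>v - z\<bar> + c" for v using Lip[of v z] unfolding c_def by linarith
  have c0: "0 \<le> c" unfolding c_def by simp
  show ?case
  proof (cases "y \<le> a")
    case True
    have "(\<Sum>i<n. \<bar>f (h (u (Suc i))) - f (h (u i))\<bar>) \<le> (\<Sum>i<n. L * \<bar>h (u (Suc i)) - h (u i)\<bar>)"
      by (intro sum_mono Lip)
    also have "\<dots> = L * V" unfolding V_def by (simp add: sum_distrib_left)
    finally have "(\<Sum>i<n. \<bar>f (h (u (Suc i))) - f (h (u i))\<bar>) + \<bar>f (h x) - z\<bar>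
        \<le> L * (V + \<bar>h x - z\<bar>) + 2 * c"
    proof -
      assume V: "(\<Sum>i<n. \<bar>f (h (u (Suc i))) - f (h (u i))\<bar>) \<le> L * V"
      have "L * \<bar>h x - z\<bar> + c \<le> L * \<bar>h x - z\<bar> + 2 * c" using c0 by simp
      note order.trans[OF fz[of "h x"] this]
      from add_mono[OF V this] show ?thesis by (simp add: distrib_left)
    qed
    also have "\<dots> \<le> L * e + 2 * c"
      using IH[of x] Cons.prems L0 by (intro add_right_mono mult_left_mono) auto
    also have "\<dots> = energy a z (p # ps)"
      using True by (simp add: gain_def displ_def p e_def L_def c_def)
    finally show ?thesis
      using True ua Cons.prems order.trans[OF True] by (simp add: act h_def)
  next
    case False
    define m where "m = max 1 L"
    have m: "1 \<le> m" "L \<le> m" unfolding m_def by auto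
    \<comment> \<open>Extra cost of the single increment that passes \<open>y\<close>: the new value
      \<open>f ?v\<close> is compared with \<open>?v\<close> through \<open>z\<close>, and each leg
      costs up to \<open>m * (e - V)\<close>, one of them with an additional
      \<open>c\<close>.\<close>
    define J where "J = 2 * m * (e - V) + c"
    let ?k = "\<lambda>v. act v p (h v)"
    have eV: "0 \<le> e - V" using IH[of x] Cons.prems by auto
    have J0: "0 \<le> J" unfolding J_def using m eV c0 by auto
    have mle: "L * w \<le> m * w" "w \<le> m * w" if "0 \<le> w" for w
      using that m mult_right_mono[OF m(2) that] mult_right_mono[OF m(1) that] by auto
    have D: "\<bar>?k v - z\<bar> \<le> m * (e - V) + c" if "a \<le> v" "v \<le> b" for v
    proof -
      have "\<bar>?k v - z\<bar> \<le> m * \<bar>h v - z\<bar> + c"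
        using add_mono[OF mle(2)[OF abs_ge_zero, of "h v - z"] c0] order.trans[OF fz[of "h v"] add_right_mono[OF mle(1)[OF abs_ge_zero]]]
        by (simp add: act)
      also have "\<dots> \<le> m * (e - V) + c"
        using IH[OF that] m by (intro add_right_mono mult_left_mono) auto
      finally show ?thesis .
    qed
    have "(\<Sum>i<n. \<bar>?k (u (Suc i)) - ?k (u i)\<bar>)
        \<le> (\<Sum>i<n. m * \<bar>h (u (Suc i)) - h (u i)\<bar> + J * (if u i < y \<and> y \<le> u (Suc i) then 1 else 0))"
    proof (rule sum_mono)
      fix i
      let ?v = "h (u (Suc i))" and ?w = "h (u i)"
      have le: "u i \<le> u (Suc i)" using u(1) by (simp add: monoD)
      consider "y \<le> u i" | "u (Suc i) < y" | "u i < y" "y \<le> u (Suc i)" by linarith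
      then show "\<bar>?k (u (Suc i)) - ?k (u i)\<bar>
          \<le> m * \<bar>?v - ?w\<bar> + J * (if u i < y \<and> y \<le> u (Suc i) then 1 else 0)"
      proof cases
        case 1
        then show ?thesis using le Lip[of ?v ?w] mle[of "\<bar>?v - ?w\<bar>"] by (auto simp: act)
      next
        case 2
        then show ?thesis using le mle[of "\<bar>?v - ?w\<bar>"] by (auto simp: act)
      next
        case 3
        have "\<bar>f ?v - ?w\<bar> \<le> \<bar>?v - ?w\<bar> + \<bar>?v - z\<bar> + \<bar>f ?v - z\<bar>" by linarith
        also have "\<dots> \<le> m * \<bar>?v - ?w\<bar> + m * \<bar>?v - z\<bar> + (m * \<bar>?v - z\<bar> + c)"
          using fz[of ?v] mle[of "\<bar>?v - z\<bar>"] mle[of "\<bar>?v - ?w\<bar>"] by auto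
        also have "\<dots> = m * \<bar>?v - ?w\<bar> + 2 * m * \<bar>?v - z\<bar> + c" by simp
        also have "\<dots> \<le> m * \<bar>?v - ?w\<bar> + 2 * m * (e - V) + c"
          using IH[of "u (Suc i)"] ua m by (intro add_right_mono add_left_mono mult_left_mono) (auto simp: algebra_simps)
        finally show ?thesis using 3 by (simp add: act J_def)
      qed
    qed
    also have "\<dots> = m * V + J * (\<Sum>i<n. if u i < y \<and> y \<le> u (Suc i) then 1 else 0)"
      unfolding V_def by (simp add: sum.distrib sum_distrib_left)
    also have "\<dots> \<le> m * V + J * 1"
      using J0 by (intro add_left_mono mult_left_mono mono_jump_count u(1))
    finally have "(\<Sum>i<n. \<bar>?k (u (Suc i)) - ?k (u i)\<bar>) + \<bar>?k x - z\<bar>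
        \<le> m * V + J + (m * (e - V) + c)"
      using D[of x] Cons.prems by auto
    \<comment> \<open>Origin of the factor 3 in \<open>gain\<close>: \<open>2 * m\<close> comes from
      the jump and \<open>m\<close> from the distance to \<open>z\<close>, each with one
      \<open>c\<close>.\<close>
    also have "\<dots> = 3 * m * e - 2 * (m * V) + 2 * c"
      unfolding J_def by (simp add: algebra_simps)
    also have "\<dots> \<le> 3 * m * e + 2 * c" using m V0 by auto
    also have "\<dots> = energy a z (p # ps)"
      using False by (simp add: gain_def displ_def p e_def L_def c_def m_def)
    finally show ?thesis by (simp add: h_def)
  qed
qed


section \<open>Deterministic bound for the limit process\<close>

text \<open>The almost sure properties of a Poisson configuration that the pathwise argument uses;
  below level \<open>b\<close> there are finitely many points in bounded time, at distinct
  times.\<close>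

locale point_config =
  fixes S :: "point set" and b :: real
  assumes lip: "p \<in> S \<Longrightarrow> snd (snd p) \<in> lipG"
    and time_nonneg: "p \<in> S \<Longrightarrow> 0 \<le> fst p"
    and inj_time: "inj_on fst {p \<in> S. fst (snd p) \<le> b}"
    and finite_pts: "finite (pts S b T)"
begin

definition strip :: "point set" where
  "strip = {p \<in> S. fst (snd p) \<le> b}"

text \<open>\<open>zeta_t\<close> sorts times rather than points; with distinct times this recovers
  the point from its time.\<close>

definition pt :: "real \<Rightarrow> point" where
  "pt \<tau> = inv_into strip fst \<tau>"

definition in_order :: "point set \<Rightarrow> point list" where
  "in_order A = map pt (sorted_list_of_set (fst ` A))"

text \<open>The strict bound, unlike the closed one in \<open>pts\<close>, makes
  \<open>before (Suc n)\<close> the disjoint union of \<open>before n\<close> and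
  \<open>slot n\<close>.\<close>

definition before :: "nat \<Rightarrow> point set" where
  "before n = {p \<in> S. fst (snd p) \<le> b \<and> fst p < real n}"

definition slot :: "nat \<Rightarrow> point set" where
  "slot n = {p \<in> S. fst (snd p) \<le> b \<and> real n \<le> fst p \<and> fst p < real n + 1}"

lemma pt_fst: "p \<in> strip \<Longrightarrow> pt (fst p) = p"
  unfolding pt_def using inj_time by (simp add: strip_def)

lemma pt_image: "A \<subseteq> strip \<Longrightarrow> pt ` fst ` A = A"
  by (simp add: image_image pt_fst subset_eq cong: image_cong)

lemma set_in_order: "finite A \<Longrightarrow> A \<subseteq> strip \<Longrightarrow> set (in_order A) = A"
  by (simp add: in_order_def pt_image)

lemma distinct_in_order:
  assumes "finite A" "A \<subseteq> strip"
  shows "distinct (in_order A)"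
proof -
  have "inj_on pt (fst ` A)"
    using assms(2) by (intro inj_on_inverseI[of _ fst]) (metis imageE pt_fst subsetD)
  then show ?thesis using assms by (simp add: in_order_def distinct_map)
qed

lemma prod_list_in_order:
  "finite A \<Longrightarrow> A \<subseteq> strip \<Longrightarrow> prod_list (map g (in_order A)) = (\<Prod>p\<in>A. g p :: real)"
  by (metis distinct_in_order prod.distinct_set_conv_list set_in_order)

lemma in_order_Un:
  assumes "finite A" "finite B" "\<And>p q. p \<in> A \<Longrightarrow> q \<in> B \<Longrightarrow> fst p < fst q"
  shows "in_order (A \<union> B) = in_order A @ in_order B"
proof -
  let ?l = "\<lambda>A. sorted_list_of_set (fst ` (A :: point set))"
  have "?l (A \<union> B) = ?l A @ ?l B"
  proof (rule sorted_distinct_set_unique)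
    show "sorted (?l A @ ?l B)" "distinct (?l A @ ?l B)"
      using assms by (fastforce simp: sorted_append intro: less_imp_le)+
  qed (use assms in \<open>auto simp: image_Un\<close>)
  then show ?thesis by (simp add: in_order_def)
qed

lemma pts_subset_strip: "pts S b T \<subseteq> strip"
  by (auto simp: pts_def strip_def)

lemma before_subset: "before n \<subseteq> strip" "before n \<subseteq> pts S b (real n)"
  by (auto simp: before_def strip_def pts_def)

lemma slot_subset: "slot n \<subseteq> strip" "slot n \<subseteq> pts S b (real n + 1)"
  by (auto simp: slot_def strip_def pts_def)

lemma finite_before: "finite (before n)" and finite_slot: "finite (slot n)"
  using finite_subset[OF before_subset(2) finite_pts] finite_subset[OF slot_subset(2) finite_pts] by auto

lemma lip_strip: "p \<in> strip \<Longrightarrow> snd (snd p) \<in> lipG"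
  using lip by (auto simp: strip_def)

text \<open>The times used at level \<open>x\<close> form a sorted sublist of those at level
  \<open>b\<close>, and \<open>act\<close> is the identity on the others.\<close>

lemma zeta_t_eq_foldr_act:
  assumes "x \<le> b"
  shows "zeta_t S z x T = foldr (act x) (in_order (pts S b T)) z"
proof -
  let ?l = "sorted_list_of_set (fst ` pts S b T)"
  have pt: "pt \<tau> \<in> S" "fst (pt \<tau>) = \<tau>" "fst (snd (pt \<tau>)) \<le> b" if "\<tau> \<in> fst ` pts S b T" for \<tau>
  proof -
    obtain p where "p \<in> strip" "\<tau> = fst p"
      using \<open>\<tau> \<in> fst ` pts S b T\<close> pts_subset_strip by (meson imageE subsetD)
    then show "pt \<tau> \<in> S" "fst (pt \<tau>) = \<tau>" "fst (snd (pt \<tau>)) \<le> b" by (auto simp: pt_fst strip_def)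
  qed
  \<comment> \<open>Distinct times below level \<open>b\<close> make the description in
    \<open>mark\<close> unique.\<close>
  have mark: "mark S x \<tau> = snd (snd (pt \<tau>))"
    if "\<tau> \<in> fst ` pts S b T" "fst (snd (pt \<tau>)) \<le> x" for \<tau>
    unfolding mark_def
  proof (rule the_equality)
    show "\<exists>y. (\<tau>, y, snd (snd (pt \<tau>))) \<in> S \<and> y \<le> x"
      using pt[OF that(1)] that(2) by (metis prod.collapse)
  next
    fix f assume "\<exists>y. (\<tau>, y, f) \<in> S \<and> y \<le> x"
    then obtain y where "(\<tau>, y, f) \<in> S" "y \<le> x" by blast
    then have "(\<tau>, y, f) \<in> strip" using assms by (simp add: strip_def)
    from pt_fst[OF this] show "f = snd (snd (pt \<tau>))" by simp
  qed
  have "sorted_list_of_set (fst ` pts S x T) = filter (\<lambda>\<tau>. fst (snd (pt \<tau>)) \<le> x) ?l"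
  proof (rule sorted_distinct_set_unique)
    have "pts S x T \<subseteq> pts S b T" using assms by (auto simp: pts_def)
    then have fin: "finite (pts S x T)" using finite_pts finite_subset by blast
    show "set (sorted_list_of_set (fst ` pts S x T)) = set (filter (\<lambda>\<tau>. fst (snd (pt \<tau>)) \<le> x) ?l)"
    proof -
      have "fst ` pts S x T = {\<tau> \<in> fst ` pts S b T. fst (snd (pt \<tau>)) \<le> x}"
      proof (intro equalityI subsetI)
        fix \<tau> assume "\<tau> \<in> fst ` pts S x T"
        then obtain p where p: "p \<in> pts S x T" "\<tau> = fst p" by auto
        with assms have "p \<in> strip" "p \<in> pts S b T" by (auto simp: pts_def strip_def)
        with p show "\<tau> \<in> {\<tau> \<in> fst ` pts S b T. fst (snd (pt \<tau>)) \<le> x}"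
          by (auto simp: pt_fst pts_def)
      next
        fix \<tau> assume \<tau>: "\<tau> \<in> {\<tau> \<in> fst ` pts S b T. fst (snd (pt \<tau>)) \<le> x}"
        then have "\<tau> \<le> T" by (auto simp: pts_def)
        with \<tau> pt[of \<tau>] show "\<tau> \<in> fst ` pts S x T" by (intro image_eqI[of _ _ "pt \<tau>"]) (auto simp: pts_def)
      qed
      then show ?thesis using fin finite_pts by simp
    qed
  qed (auto intro: sorted_wrt_filter)
  moreover have "foldr (mark S x) (filter (\<lambda>\<tau>. fst (snd (pt \<tau>)) \<le> x) l) z = foldr (act x) (map pt l) z"
    if "set l \<subseteq> fst ` pts S b T" for l
    using that by (induction l) (auto simp: act_def mark)
  ultimately show ?thesis using finite_pts[of T] unfolding zeta_t_def in_order_def by auto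
qed

lemma energy_in_order_Un:
  assumes "finite A" "finite B" "A \<subseteq> strip" "B \<subseteq> strip" "\<And>p q. p \<in> A \<Longrightarrow> q \<in> B \<Longrightarrow> fst p < fst q"
  shows "energy a z (in_order (A \<union> B)) = energy a z (in_order A) + (\<Prod>p\<in>A. gain a p) * energy a z (in_order B)"
  using assms by (simp add: in_order_Un energy_append prod_list_in_order)

lemma energy_in_order_nonneg: "finite A \<Longrightarrow> A \<subseteq> strip \<Longrightarrow> 0 \<le> energy a z (in_order A)"
  using lip_strip by (intro energy_nonneg) (auto simp: set_in_order subset_eq)

lemma prod_gain_strip_nonneg: "A \<subseteq> strip \<Longrightarrow> 0 \<le> (\<Prod>p\<in>A. gain a p)"
  using lip_strip by (intro prod_nonneg gain_nonneg) (auto simp: subset_eq)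

text \<open>Slot \<open>N\<close> acts inside everything earlier, so its energy enters damped by the
  gains of \<open>before N\<close>.\<close>

lemma energy_before:
  "energy a z (in_order (before N))
    \<le> (\<Sum>n<N. (\<Prod>p\<in>before n. gain a p) * (\<Prod>p\<in>slot n. 1 + gain a p + 2 * displ z p))"
proof (induction N)
  case 0
  have "before 0 = {}" using time_nonneg by (force simp: before_def)
  then show ?case by (simp add: in_order_def)
next
  case (Suc N)
  have eq: "before (Suc N) = before N \<union> slot N" by (auto simp: before_def slot_def)
  have "energy a z (in_order (slot N)) \<le> (\<Prod>p\<in>slot N. 1 + gain a p + 2 * displ z p)"
    unfolding prod_list_in_order[OF finite_slot slot_subset(1), symmetric]
    using lip_strip slot_subset(1)
    by (intro energy_le_prod) (auto simp: set_in_order finite_slot slot_subset(1) subset_eq)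
  then have "(\<Prod>p\<in>before N. gain a p) * energy a z (in_order (slot N))
      \<le> (\<Prod>p\<in>before N. gain a p) * (\<Prod>p\<in>slot N. 1 + gain a p + 2 * displ z p)"
    by (intro mult_left_mono prod_gain_strip_nonneg before_subset)
  moreover have "energy a z (in_order (before (Suc N)))
      = energy a z (in_order (before N)) + (\<Prod>p\<in>before N. gain a p) * energy a z (in_order (slot N))"
    unfolding eq by (rule energy_in_order_Un)
      (use finite_before finite_slot before_subset slot_subset in \<open>auto simp: before_def slot_def\<close>)
  ultimately show ?case using Suc by simp
qed

text \<open>\<open>E T\<close> increases to a limit at most \<open>C\<close> and its increments
  dominate those of \<open>zeta_t\<close>. This gives convergence; each variation sum has finitely
  many terms, so the bound \<open>C\<close> survives the limit.\<close>

lemma bvar_zeta: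
  assumes summable: "summable (\<lambda>n. (\<Prod>p\<in>before n. gain a p) * (\<Prod>p\<in>slot n. 1 + gain a p + 2 * displ z p))"
  shows "bvar (zeta S z) a b"
proof -
  define E where "E T = energy a z (in_order (pts S b T))" for T
  define C where "C = (\<Sum>n. (\<Prod>p\<in>before n. gain a p) * (\<Prod>p\<in>slot n. 1 + gain a p + 2 * displ z p))"
  have terms0: "0 \<le> (\<Prod>p\<in>before n. gain a p) * (\<Prod>p\<in>slot n. 1 + gain a p + 2 * displ z p)" for n
    using lip_strip slot_subset before_subset
    by (intro mult_nonneg_nonneg prod_gain_strip_nonneg prod_nonneg add_nonneg_nonneg gain_nonneg) (auto simp: subset_eq)
  have EC: "E T \<le> C" for T
  proof -
    obtain N where N: "T < real N" using reals_Archimedean2 by blast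
    let ?R = "before N - pts S b T"
    have "before N = pts S b T \<union> ?R" using N by (auto simp: before_def pts_def)
    then have "energy a z (in_order (before N)) = energy a z (in_order (pts S b T \<union> ?R))" by simp
    also have "\<dots> = E T + (\<Prod>p\<in>pts S b T. gain a p) * energy a z (in_order ?R)"
      unfolding E_def by (rule energy_in_order_Un)
        (use finite_before finite_pts before_subset pts_subset_strip in \<open>auto simp: before_def pts_def\<close>)
    finally have "E T \<le> energy a z (in_order (before N))"
      using mult_nonneg_nonneg[OF prod_gain_strip_nonneg[OF pts_subset_strip[of T], of a] energy_in_order_nonneg[of ?R a z]]
        finite_before before_subset by fastforce
    also note energy_before
    also have "(\<Sum>n<N. (\<Prod>p\<in>before n. gain a p) * (\<Prod>p\<in>slot n. 1 + gain a p + 2 * displ z p)) \<le> C"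
      unfolding C_def by (rule sum_le_suminf[OF summable]) (use terms0 in auto)
    finally show ?thesis .
  qed
  have lip_in_order: "snd (snd p) \<in> lipG" if "p \<in> set (in_order A)" "finite A" "A \<subseteq> strip" for p A
    using that(1) unfolding set_in_order[OF that(2,3)] using that(3) lip_strip by blast
  have conv: "\<exists>l. ((\<lambda>T. zeta_t S z x T) \<longlongrightarrow> l) at_top" if x: "a \<le> x" "x \<le> b" for x
  proof -
    have dist: "\<bar>foldr (act x) (in_order A) z - z\<bar> \<le> energy a z (in_order A)" if "finite A" "A \<subseteq> strip" for A
      using variation_le_energy[of "in_order A" "\<lambda>_. x" a b x, where n = 0 and z = z] lip_in_order[OF _ that] x
      by (auto simp: mono_def)
    \<comment> \<open>The points of \<open>?R\<close> move the start from \<open>z\<close> by at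
      most their energy, and the earlier gains multiply this: exactly the increment of
      \<open>E\<close>.\<close>
    have step: "\<bar>zeta_t S z x T' - zeta_t S z x T\<bar> \<le> E T' - E T" if TT: "T \<le> T'" for T T'
    proof -
      let ?R = "pts S b T' - pts S b T"
      have R: "finite ?R" "?R \<subseteq> strip" using finite_pts pts_subset_strip by auto
      have eq: "pts S b T' = pts S b T \<union> ?R" using TT by (auto simp: pts_def)
      have lt: "fst p < fst q" if "p \<in> pts S b T" "q \<in> ?R" for p q using that by (auto simp: pts_def)
      have "zeta_t S z x T' = foldr (act x) (in_order (pts S b T)) (foldr (act x) (in_order ?R) z)"
      proof -
        have "in_order (pts S b T \<union> ?R) = in_order (pts S b T) @ in_order ?R"
          by (rule in_order_Un) (use finite_pts R lt in auto)
        then show ?thesis unfolding eq[symmetric] by (simp add: zeta_t_eq_foldr_act[OF x(2)])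
      qed
      then have "\<bar>zeta_t S z x T' - zeta_t S z x T\<bar>
          \<le> prod_list (map (gain a) (in_order (pts S b T))) * \<bar>foldr (act x) (in_order ?R) z - z\<bar>"
        using foldr_act_contract[OF lip_in_order[OF _ finite_pts pts_subset_strip] x(1)]
        by (simp add: zeta_t_eq_foldr_act[OF x(2)])
      also have "\<dots> \<le> (\<Prod>p\<in>pts S b T. gain a p) * energy a z (in_order ?R)"
        using dist[OF R] by (simp add: prod_list_in_order finite_pts pts_subset_strip mult_left_mono prod_gain_strip_nonneg)
      also have "\<dots> = E T' - E T"
      proof -
        have "energy a z (in_order (pts S b T \<union> ?R))
            = energy a z (in_order (pts S b T)) + (\<Prod>p\<in>pts S b T. gain a p) * energy a z (in_order ?R)"
          by (rule energy_in_order_Un) (use finite_pts R lt pts_subset_strip in auto)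
        then show ?thesis unfolding E_def eq[symmetric] by simp
      qed
      finally show ?thesis .
    qed
    have bounded: "\<bar>zeta_t S z x T - z\<bar> \<le> C" for T
      using dist[OF finite_pts pts_subset_strip, of T] EC[of T]
      by (simp add: zeta_t_eq_foldr_act[OF x(2)] E_def)
    have mono_lim: "\<exists>l. (g \<longlongrightarrow> l) at_top" if "mono g" "\<And>T. g T \<le> K" for g :: "real \<Rightarrow> real" and K
    proof (intro exI increasing_tendsto)
      have bdd: "bdd_above (range g)" by (rule bdd_aboveI[of _ K]) (use that(2) in auto)
      show "\<forall>\<^sub>F T in at_top. g T \<le> (SUP T. g T)" by (intro always_eventually allI cSUP_upper bdd) auto
      fix y assume "y < (SUP T. g T)"
      then obtain T0 where "y < g T0" using less_cSUP_iff[OF _ bdd] by auto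
      then show "\<forall>\<^sub>F T in at_top. y < g T"
        using monoD[OF that(1)] by (intro eventually_at_top_linorderI[of T0]) (auto intro: less_le_trans)
    qed
    \<comment> \<open>Since \<open>E\<close> dominates the increments in absolute value, both
      combinations increase; half their difference is \<open>zeta_t\<close>.\<close>
    have "mono (\<lambda>T. E T + zeta_t S z x T)" "mono (\<lambda>T. E T - zeta_t S z x T)"
      using step by (auto intro!: monoI simp: abs_le_iff) (smt (verit))+
    moreover have "E T + zeta_t S z x T \<le> 2 * C + z" "E T - zeta_t S z x T \<le> 2 * C - z" for T
      using EC[of T] bounded[of T] by (auto simp: abs_le_iff)
    ultimately obtain l1 l2 where "((\<lambda>T. E T + zeta_t S z x T) \<longlongrightarrow> l1) at_top"
        "((\<lambda>T. E T - zeta_t S z x T) \<longlongrightarrow> l2) at_top"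
      using mono_lim[of "\<lambda>T. E T + zeta_t S z x T" "2 * C + z"]
        mono_lim[of "\<lambda>T. E T - zeta_t S z x T" "2 * C - z"] by blast
    from tendsto_divide[OF tendsto_diff[OF this] tendsto_const[of 2]]
    show ?thesis by auto
  qed
  \<comment> \<open>\<open>Lim\<close> denotes the limit only once convergence is known.\<close>
  then have lim: "((\<lambda>T. zeta_t S z x T) \<longlongrightarrow> zeta S z x) at_top" if "a \<le> x" "x \<le> b" for x
    using that tendsto_Lim[OF trivial_limit_at_top_linorder] unfolding zeta_def by metis
  have "(\<Sum>i<n. \<bar>zeta S z (u (Suc i)) - zeta S z (u i)\<bar>) \<le> C"
    if u: "mono u" "range u \<subseteq> {a..b}" for u and n :: nat
  proof (rule tendsto_upperbound)
    have ua: "a \<le> u i" "u i \<le> b" for i using u(2) by (auto simp: subset_eq)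
    show "((\<lambda>T. \<Sum>i<n. \<bar>zeta_t S z (u (Suc i)) T - zeta_t S z (u i) T\<bar>)
        \<longlongrightarrow> (\<Sum>i<n. \<bar>zeta S z (u (Suc i)) - zeta S z (u i)\<bar>)) at_top"
      by (intro tendsto_intros lim ua)
    show "\<forall>\<^sub>F T in at_top. (\<Sum>i<n. \<bar>zeta_t S z (u (Suc i)) T - zeta_t S z (u i) T\<bar>) \<le> C"
    proof (intro always_eventually allI)
      fix T
      have "(\<Sum>i<n. \<bar>zeta_t S z (u (Suc i)) T - zeta_t S z (u i) T\<bar>) \<le> E T"
      proof -
        let ?h = "\<lambda>x. foldr (act x) (in_order (pts S b T)) z"
        have "(\<Sum>i<n. \<bar>?h (u (Suc i)) - ?h (u i)\<bar>) + \<bar>?h (u 0) - z\<bar> \<le> E T"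
          unfolding E_def
          by (rule variation_le_energy[OF lip_in_order[OF _ finite_pts pts_subset_strip] u ua(1) ua(2)])
        moreover have "0 \<le> \<bar>?h (u 0) - z\<bar>" by simp
        ultimately have "(\<Sum>i<n. \<bar>?h (u (Suc i)) - ?h (u i)\<bar>) \<le> E T" by linarith
        then show ?thesis by (simp add: zeta_t_eq_foldr_act ua)
      qed
      also note EC
      finally show "(\<Sum>i<n. \<bar>zeta_t S z (u (Suc i)) T - zeta_t S z (u i) T\<bar>) \<le> C" .
    qed
  qed simp
  then show ?thesis unfolding bvar_def by blast
qed

end


section \<open>The intensity measure\<close>

definition box3 :: "real set \<Rightarrow> real set \<Rightarrow> point set" where
  "box3 I J = I \<times> J \<times> lipG"

locale lip_prob = prob_space \<nu> for \<nu> :: "(real \<Rightarrow> real) measure" +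
  assumes sets_nu: "sets \<nu> = sets G_borel"
begin

lemma space_nu: "space \<nu> = lipG"
  using sets_eq_imp_space_eq[OF sets_nu] by simp

lemma lipconst_meas [measurable]: "lipconst \<in> borel_measurable \<nu>"
  using lipconst_measurable measurable_cong_sets[OF sets_nu refl] by blast

lemma eval_meas [measurable]: "(\<lambda>f. f z) \<in> borel_measurable \<nu>"
  using eval_measurable measurable_cong_sets[OF sets_nu refl] by blast

lemma space_lborel_nonneg: "space lborel_nonneg = {0..}"
  by (simp add: lborel_nonneg_def space_restrict_space)

lemma sets_lborel_nonneg: "I \<in> sets borel \<Longrightarrow> I \<subseteq> {0..} \<Longrightarrow> I \<in> sets lborel_nonneg"
  unfolding lborel_nonneg_def sets_restrict_space by (auto intro!: image_eqI[of _ _ I])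

lemma borel_id_lborel_nonneg [measurable]: "(\<lambda>x. x) \<in> borel_measurable lborel_nonneg"
  unfolding lborel_nonneg_def by (intro measurable_restrict_space1) simp

lemma emeasure_lborel_nonneg:
  "I \<subseteq> {0..} \<Longrightarrow> emeasure lborel_nonneg I = emeasure lborel I"
  unfolding lborel_nonneg_def by (rule emeasure_restrict_space) auto

sublocale lborel_nonneg: sigma_finite_measure lborel_nonneg
  unfolding lborel_nonneg_def
  by (rule sigma_finite_measure_restrict_space) (auto intro: lborel.sigma_finite_measure_axioms)

sublocale inner: sigma_finite_measure "lborel_nonneg \<Otimes>\<^sub>M \<nu>"
  by (rule sigma_finite_pair_measure) unfold_locales

lemma space_intensity: "space (intensity \<nu>) = {0..} \<times> {0..} \<times> lipG"
  by (simp add: intensity_def space_pair_measure space_lborel_nonneg space_nu)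

lemma box3_sets:
  assumes "I \<in> sets borel" "I \<subseteq> {0..}" "J \<in> sets borel" "J \<subseteq> {0..}"
  shows "box3 I J \<in> sets (intensity \<nu>)"
  unfolding box3_def intensity_def using assms sets.top[of \<nu>]
  by (intro pair_measureI sets_lborel_nonneg) (auto simp: space_nu)

lemma measurable_intensity [measurable]:
  "fst \<in> borel_measurable (intensity \<nu>)"
  "(\<lambda>p. fst (snd p)) \<in> borel_measurable (intensity \<nu>)"
  "(\<lambda>p. snd (snd p)) \<in> measurable (intensity \<nu>) \<nu>"
proof -
  show "fst \<in> borel_measurable (intensity \<nu>)"
    unfolding intensity_def using measurable_compose[OF measurable_fst borel_id_lborel_nonneg] by simp
  show "(\<lambda>p. fst (snd p)) \<in> borel_measurable (intensity \<nu>)"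
    unfolding intensity_def
    using measurable_compose[OF measurable_snd measurable_compose[OF measurable_fst borel_id_lborel_nonneg]] by simp
  show "(\<lambda>p. snd (snd p)) \<in> measurable (intensity \<nu>) \<nu>"
    unfolding intensity_def using measurable_compose[OF measurable_snd measurable_snd] by simp
qed

lemma nn_integral_box3:
  assumes I: "I \<in> sets borel" "I \<subseteq> {0..}" and J: "J \<in> sets borel" "J \<subseteq> {0..}"
    and h [measurable]: "h \<in> borel_measurable \<nu>"
  shows "(\<integral>\<^sup>+ p\<in>box3 I J. h (snd (snd p)) \<partial>intensity \<nu>)
    = emeasure lborel I * emeasure lborel J * (\<integral>\<^sup>+ f. h f \<partial>\<nu>)"
proof -
  have [measurable]: "I \<in> sets lborel_nonneg" "J \<in> sets lborel_nonneg" using sets_lborel_nonneg I J by auto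
  have "(\<integral>\<^sup>+ p\<in>box3 I J. h (snd (snd p)) \<partial>intensity \<nu>)
      = (\<integral>\<^sup>+ p. indicator I (fst p) * (indicator J (fst (snd p)) * h (snd (snd p))) \<partial>intensity \<nu>)"
    by (intro nn_integral_cong) (auto simp: box3_def indicator_def space_intensity)
  also have "\<dots> = (\<integral>\<^sup>+ t. \<integral>\<^sup>+ q. indicator I t * (indicator J (fst q) * h (snd q)) \<partial>(lborel_nonneg \<Otimes>\<^sub>M \<nu>) \<partial>lborel_nonneg)"
    unfolding intensity_def by (subst inner.nn_integral_fst[symmetric]) auto
  also have "\<dots> = (\<integral>\<^sup>+ t. indicator I t * (\<integral>\<^sup>+ q. indicator J (fst q) * h (snd q) \<partial>(lborel_nonneg \<Otimes>\<^sub>M \<nu>)) \<partial>lborel_nonneg)"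
    by (intro nn_integral_cong nn_integral_cmult) measurable
  also have "\<dots> = emeasure lborel I * (\<integral>\<^sup>+ q. indicator J (fst q) * h (snd q) \<partial>(lborel_nonneg \<Otimes>\<^sub>M \<nu>))"
    using I by (simp add: nn_integral_multc emeasure_lborel_nonneg)
  also have "(\<integral>\<^sup>+ q. indicator J (fst q) * h (snd q) \<partial>(lborel_nonneg \<Otimes>\<^sub>M \<nu>))
      = (\<integral>\<^sup>+ y. \<integral>\<^sup>+ f. indicator J y * h f \<partial>\<nu> \<partial>lborel_nonneg)"
    by (subst nn_integral_fst[symmetric]) auto
  also have "\<dots> = (\<integral>\<^sup>+ y. indicator J y * (\<integral>\<^sup>+ f. h f \<partial>\<nu>) \<partial>lborel_nonneg)"
    by (intro nn_integral_cong nn_integral_cmult) measurable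
  also have "\<dots> = emeasure lborel J * (\<integral>\<^sup>+ f. h f \<partial>\<nu>)"
    using J by (simp add: nn_integral_multc emeasure_lborel_nonneg)
  finally show ?thesis by (simp add: mult.assoc)
qed

lemma emeasure_box3:
  assumes "I \<in> sets borel" "I \<subseteq> {0..}" "J \<in> sets borel" "J \<subseteq> {0..}"
  shows "emeasure (intensity \<nu>) (box3 I J) = emeasure lborel I * emeasure lborel J"
  using nn_integral_box3[OF assms, of "\<lambda>_. 1"] box3_sets[OF assms] by (simp add: emeasure_space_1)

section \<open>Distinct times and local finiteness\<close>

text \<open>Two points with equal times lie in a common slab for every subdivision of the time
  interval into \<open>n\<close> slabs, and some slab holds two points with probability at most
  \<open>(m * b)\<^sup>2 / n\<close>.\<close>

lemma AE_distinct_times: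
  assumes PP: "poisson_process M P (intensity \<nu>)" and m: "m > 0" and b: "b \<ge> 0"
  shows "AE \<omega> in M. inj_on fst (P \<omega> \<inter> box3 {0..<m} {0..b})"
proof -
  interpret M: prob_space M using PP by (rule poisson_process_prob_space)
  define C where "C n i = box3 {real i * m / real n..<real (Suc i) * m / real n} {0..b}" for n i :: nat
  have ge0: "0 \<le> real i * m / real n" for i n :: nat using m by simp
  have C: "C n i \<in> sets (intensity \<nu>)" for n i
    unfolding C_def by (intro box3_sets) (auto intro: order.trans[OF ge0])
  have eC: "emeasure (intensity \<nu>) (C n i) = ennreal (m / real n * b)" for n i
  proof -
    have "emeasure (intensity \<nu>) (C n i)
        = emeasure lborel {real i * m / real n..<real (Suc i) * m / real n} * emeasure lborel {0..b}"
      unfolding C_def by (intro emeasure_box3) (auto intro: order.trans[OF ge0])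
    also have "\<dots> = ennreal (real (Suc i) * m / real n - real i * m / real n) * ennreal (b - 0)"
      using m b by (subst emeasure_lborel_Ico) (auto intro!: divide_right_mono mult_right_mono)
    also have "real (Suc i) * m / real n - real i * m / real n = m / real n"
      by (simp add: field_simps flip: diff_divide_distrib)
    finally show ?thesis using m b ennreal_mult[of "m / real n" b] by simp
  qed
  then have mC: "measure (intensity \<nu>) (C n i) = m / real n * b" for n i
    using m b by (simp add: measure_def)
  have fC: "emeasure (intensity \<nu>) (C n i) < \<infinity>" for n i by (simp add: eC)
  define E where "E n = (\<Union>i<n. {\<omega>\<in>space M. 2 \<le> card (P \<omega> \<inter> C n i)})" for n
  have [measurable]: "(\<lambda>\<omega>. card (P \<omega> \<inter> C n i)) \<in> measurable M (count_space UNIV)" for n i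
    by (rule poisson_process_count_measurable[OF PP C fC])
  have E [measurable]: "E n \<in> sets M" for n unfolding E_def by measurable
  have mE: "measure M (E n) \<le> (m * b)\<^sup>2 / real n" if "n > 0" for n
  proof -
    have "measure M (E n) \<le> (\<Sum>i<n. measure M {\<omega>\<in>space M. 2 \<le> card (P \<omega> \<inter> C n i)})"
      unfolding E_def by (rule M.finite_measure_subadditive_finite) auto
    also have "\<dots> \<le> (\<Sum>i<n. (m / real n * b)\<^sup>2)"
      using poisson_process_card_ge_2[OF PP C fC] by (intro sum_mono) (simp add: mC)
    also have "\<dots> = (m * b)\<^sup>2 / real n" using that by (simp add: power2_eq_square field_simps)
    finally show ?thesis .
  qed
  have "(\<lambda>n. (m * b)\<^sup>2 / real n) \<longlonglongrightarrow> 0" by (rule lim_const_over_n)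
  \<comment> \<open>The index 0 must be left out: \<open>E 0\<close> is empty and would make the
    intersection trivially null.\<close>
  then have "measure M (\<Inter>n\<in>{0<..}. E n) \<le> 0"
  proof (rule tendsto_lowerbound)
    show "\<forall>\<^sub>F n in sequentially. measure M (\<Inter>n\<in>{0<..}. E n) \<le> (m * b)\<^sup>2 / real n"
      using eventually_gt_at_top[of 0]
    proof eventually_elim
      fix n :: nat assume n: "n > 0"
      have "measure M (\<Inter>n\<in>{0<..}. E n) \<le> measure M (E n)" using n by (intro M.finite_measure_mono) auto
      with mE[OF n] show "measure M (\<Inter>n\<in>{0<..}. E n) \<le> (m * b)\<^sup>2 / real n" by simp
    qed
  qed simp
  then have "(\<Inter>n\<in>{0<..}. E n) \<in> null_sets M"
    using antisym[OF _ measure_nonneg[of M "\<Inter>n\<in>{0<..}. E n"]] E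
    by (auto simp: null_sets_def M.emeasure_eq_measure simp del: measure_le_0_iff)
  from AE_not_in[OF this] have 1: "AE \<omega> in M. \<omega> \<notin> (\<Inter>n\<in>{0<..}. E n)" .
  \<comment> \<open>An infinite intersection would have \<open>card\<close> 0 and escape
    \<open>E n\<close>.\<close>
  have 2: "AE \<omega> in M. \<forall>n i. finite (P \<omega> \<inter> C n i)"
    using poisson_process_AE_finite[OF PP C fC] by (simp add: AE_all_countable)
  show ?thesis using 1 2 AE_space
  proof eventually_elim
    fix \<omega> assume nE: "\<omega> \<notin> (\<Inter>n\<in>{0<..}. E n)" and fin: "\<forall>n i. finite (P \<omega> \<inter> C n i)" and \<omega>: "\<omega> \<in> space M"
    from nE obtain n where n: "n > 0" "\<omega> \<notin> E n" by auto
    show "inj_on fst (P \<omega> \<inter> box3 {0..<m} {0..b})"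
    proof (rule inj_onI, rule ccontr)
      fix p q assume p: "p \<in> P \<omega> \<inter> box3 {0..<m} {0..b}" and q: "q \<in> P \<omega> \<inter> box3 {0..<m} {0..b}"
        and eq: "fst p = fst q" and ne: "p \<noteq> q"
      define i where "i = nat \<lfloor>fst p * real n / m\<rfloor>"
      have t: "0 \<le> fst p" "fst p < m" using p by (auto simp: box3_def)
      have pos: "0 \<le> fst p * real n / m" using t m by simp
      have i: "real i \<le> fst p * real n / m" "fst p * real n / m < real (Suc i)"
      proof -
        have "real i = of_int \<lfloor>fst p * real n / m\<rfloor>" using pos by (simp add: i_def)
        then show "real i \<le> fst p * real n / m" "fst p * real n / m < real (Suc i)"
          using floor_correct[of "fst p * real n / m"] unfolding of_nat_Suc by linarith+
      qed
      have "fst p * real n / m < real n" using t m n by (simp add: field_simps)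
      with i have "i < n" by linarith
      have "real i * m / real n \<le> fst p" "fst p < real (Suc i) * m / real n"
        using i m n by (simp_all add: field_simps)
      with p q eq have "{p, q} \<subseteq> P \<omega> \<inter> C n i" by (auto simp: C_def box3_def)
      then have "card {p, q} \<le> card (P \<omega> \<inter> C n i)" using fin by (intro card_mono) auto
      then have "2 \<le> card (P \<omega> \<inter> C n i)" using ne by simp
      with \<open>i < n\<close> \<omega> n(2) show False by (auto simp: E_def)
    qed
  qed
qed

text \<open>Boxes with integer sides exhaust the space, so countably many null sets suffice for all
  real \<open>b\<close> and all times.\<close>

lemma AE_point_config:
  assumes PP: "poisson_process M P (intensity \<nu>)"
  shows "AE \<omega> in M. \<forall>b. point_config (P \<omega>) b"
proof -
  have 1: "AE \<omega> in M. \<forall>m k. inj_on fst (P \<omega> \<inter> box3 {0..<real (Suc m)} {0..real k})"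
    using AE_distinct_times[OF PP] by (simp add: AE_all_countable)
  have 0: "box3 {0..<real (Suc m)} {0..real k} \<in> sets (intensity \<nu>)"
    "emeasure (intensity \<nu>) (box3 {0..<real (Suc m)} {0..real k}) < \<infinity>" for m k
  proof -
    show "box3 {0..<real (Suc m)} {0..real k} \<in> sets (intensity \<nu>)"
      by (rule box3_sets) auto
    have "emeasure (intensity \<nu>) (box3 {0..<real (Suc m)} {0..real k})
        = emeasure lborel {0..<real (Suc m)} * emeasure lborel {0..real k}"
      by (rule emeasure_box3) auto
    then show "emeasure (intensity \<nu>) (box3 {0..<real (Suc m)} {0..real k}) < \<infinity>"
      by (simp add: ennreal_mult_less_top del: of_nat_Suc)
  qed
  from 0 have 2: "AE \<omega> in M. \<forall>m k. finite (P \<omega> \<inter> box3 {0..<real (Suc m)} {0..real k})"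
    using poisson_process_AE_finite[OF PP] by (simp add: AE_all_countable)
  show ?thesis using 1 2 AE_space
  proof (eventually_elim, intro allI)
    fix \<omega> b
    assume inj: "\<forall>m k. inj_on fst (P \<omega> \<inter> box3 {0..<real (Suc m)} {0..real k})"
      and fin: "\<forall>m k. finite (P \<omega> \<inter> box3 {0..<real (Suc m)} {0..real k})" and \<omega>: "\<omega> \<in> space M"
    have P: "p \<in> {0..} \<times> {0..} \<times> lipG" if "p \<in> P \<omega>" for p
      using PP \<omega> that unfolding poisson_process_def space_intensity by blast
    obtain k where k: "b \<le> real k" using real_arch_simple by blast
    \<comment> \<open>The half-open range up to \<open>Suc m\<close> also contains points at time
      exactly \<open>m\<close>.\<close>
    have in_box: "p \<in> P \<omega> \<inter> box3 {0..<real (Suc m)} {0..real k}"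
      if "p \<in> P \<omega>" "fst (snd p) \<le> b" "fst p \<le> real m" for p m
      using that P[of p] k by (auto simp: box3_def)
    show "point_config (P \<omega>) b"
    proof
      fix p assume "p \<in> P \<omega>"
      from P[OF this] show "snd (snd p) \<in> lipG" "0 \<le> fst p" by auto
    next
      show "inj_on fst {p \<in> P \<omega>. fst (snd p) \<le> b}"
      proof (rule inj_onI)
        fix p q assume pq: "p \<in> {p \<in> P \<omega>. fst (snd p) \<le> b}" "q \<in> {p \<in> P \<omega>. fst (snd p) \<le> b}"
          and eq: "fst p = fst q"
        obtain m where "fst p \<le> real m" using real_arch_simple by blast
        with pq eq in_box[of p m] in_box[of q m] inj show "p = q"
          by (auto dest: inj_onD)
      qed
    next
      fix T
      obtain m where "T \<le> real m" using real_arch_simple by blast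
      then have "pts (P \<omega>) b T \<subseteq> P \<omega> \<inter> box3 {0..<real (Suc m)} {0..real k}"
        using in_box by (auto simp: pts_def)
      then show "finite (pts (P \<omega>) b T)" using fin finite_subset by blast
    qed
  qed
qed

end


section \<open>Exponential decay of the weights\<close>

lemma powr_le_self_of_ge_1:
  fixes x :: real
  assumes "1 \<le> x" "s \<le> 1"
  shows "x powr s \<le> x"
  using powr_mono[OF assms(2,1)] assms(1) by simp

lemma prod_powr:
  fixes g :: "'a \<Rightarrow> real"
  assumes "\<And>p. p \<in> A \<Longrightarrow> 0 \<le> g p"
  shows "(\<Prod>p\<in>A. g p powr s) = (\<Prod>p\<in>A. g p) powr s"
  using assms
proof (induction A rule: infinite_finite_induct)
  case (insert p A)
  then show ?case by (simp add: powr_mult prod_nonneg)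
qed auto

context lip_prob
begin

text \<open>The \<open>s\<close>-th power of the \<open>n\<close>-th term of the series in \<open>bvar_zeta\<close> is a product over
  the points with time below \<open>n + 1\<close>. Points with \<open>y \<le> a\<close> contribute a factor \<open>E L\<^sup>s < 1\<close>
  per unit area, and for \<open>b\<close> close to \<open>a\<close> this outweighs the contribution of \<open>a < y \<le> b\<close>.\<close>
lemma AE_summable_weights:
  assumes PP: "poisson_process M P (intensity \<nu>)"
    and ab: "0 < a" "a < b" and s: "0 < s" "s \<le> 1"
    and \<rho>: "0 \<le> \<rho>" "(\<integral>\<^sup>+ f. ennreal (lipconst f powr s) \<partial>\<nu>) \<le> ennreal \<rho>"
    and \<kappa>: "0 \<le> \<kappa>" "(\<integral>\<^sup>+ f. ennreal (3 + 3 * lipconst f) \<partial>\<nu>) \<le> ennreal \<kappa>"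
    and \<eta>: "0 \<le> \<eta>" "(\<integral>\<^sup>+ f. ennreal (4 + 3 * lipconst f + 2 * \<bar>f z - z\<bar>) \<partial>\<nu>) \<le> ennreal \<eta>"
    and contr: "a * \<rho> + (b - a) * \<kappa> < b"
  shows "AE \<omega> in M. summable (\<lambda>n. (\<Prod>p\<in>point_config.before (P \<omega>) b n. gain a p) *
     (\<Prod>p\<in>point_config.slot (P \<omega>) b n. 1 + gain a p + 2 * displ z p))"
proof -
  interpret M: prob_space M using PP by (rule poisson_process_prob_space)
  define A where "A n = box3 {0..<real (Suc n)} {0..b}" for n
  \<comment> \<open>A single weight encodes both products of the \<open>n\<close>-th term:
    \<open>gain\<close> before time \<open>n\<close>, the cruder slot factor afterwards.\<close>
  define w where "w n p = (if fst p < real n then gain a p else 1 + gain a p + 2 * displ z p)" for n p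
  define g where "g n p = w n p powr s" for n p
  have A: "A n \<in> sets (intensity \<nu>)" for n unfolding A_def by (rule box3_sets) auto
  have eA: "emeasure (intensity \<nu>) (A n) = ennreal ((real n + 1) * b)" for n
  proof -
    have "emeasure (intensity \<nu>) (A n) = emeasure lborel {0..<real (Suc n)} * emeasure lborel {0..b}"
      unfolding A_def by (rule emeasure_box3) auto
    also have "\<dots> = ennreal (real n + 1) * ennreal b" using ab by (simp add: add.commute)
    finally show ?thesis using ab by (simp add: ennreal_mult)
  qed
  have fA: "emeasure (intensity \<nu>) (A n) < \<infinity>" for n by (simp add: eA)
  have mA: "measure (intensity \<nu>) (A n) = (real n + 1) * b" for n using eA ab by (simp add: measure_def)
  have [measurable]: "gain a \<in> borel_measurable (intensity \<nu>)" "displ z \<in> borel_measurable (intensity \<nu>)"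
    unfolding gain_def displ_def by measurable
  have g: "g n \<in> borel_measurable (intensity \<nu>)" for n
    unfolding g_def w_def by measurable
  \<comment> \<open>The three summands belong to boxes of area \<open>n * a\<close>,
    \<open>n * (b - a)\<close> and \<open>b\<close>.\<close>
  define K where "K n = real n * a * \<rho> + real n * (b - a) * \<kappa> + b * \<eta>" for n
  have K0: "0 \<le> K n" for n using ab \<rho> \<kappa> \<eta> by (simp add: K_def)
  have intK: "(\<integral>\<^sup>+ p\<in>A n. ennreal (g n p) \<partial>intensity \<nu>) \<le> ennreal (K n)" for n
  proof -
    let ?B1 = "box3 {0..<real n} {0..a}" and ?B2 = "box3 {0..<real n} {a<..b}"
      and ?B3 = "box3 {real n..<real (Suc n)} {0..b}"
    let ?h1 = "\<lambda>f. ennreal (lipconst f powr s)" and ?h2 = "\<lambda>f. ennreal (3 + 3 * lipconst f)"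
      and ?h3 = "\<lambda>f. ennreal (4 + 3 * lipconst f + 2 * \<bar>f z - z\<bar>)"
    have B: "?B1 \<in> sets (intensity \<nu>)" "?B2 \<in> sets (intensity \<nu>)" "?B3 \<in> sets (intensity \<nu>)"
      using ab by (auto intro!: box3_sets)
    have "(\<integral>\<^sup>+ p\<in>A n. ennreal (g n p) \<partial>intensity \<nu>)
        \<le> (\<integral>\<^sup>+ p. ?h1 (snd (snd p)) * indicator ?B1 p + ?h2 (snd (snd p)) * indicator ?B2 p
          + ?h3 (snd (snd p)) * indicator ?B3 p \<partial>intensity \<nu>)"
    proof (rule nn_integral_mono)
      fix p assume "p \<in> space (intensity \<nu>)"
      obtain t y f where p: "p = (t, y, f)" by (cases p)
      have "0 \<le> t" "0 \<le> y" and f: "f \<in> lipG" using \<open>p \<in> _\<close> by (auto simp: p space_intensity)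
      have L: "0 \<le> lipconst f" using f by (rule lipconst_nonneg)
      have m: "3 * max 1 (lipconst f) \<le> 3 + 3 * lipconst f" using L by auto
      have m2: "(3 * max 1 (lipconst f)) powr s \<le> 3 + 3 * lipconst f"
        by (rule order.trans[OF powr_le_self_of_ge_1 m]) (use s in auto)
      have g0: "0 \<le> gain a p" "gain a p \<le> 3 + 3 * lipconst f" using m L by (auto simp: gain_def p)
      have m3: "(1 + gain a p + 2 * displ z p) powr s \<le> 4 + 3 * lipconst f + 2 * \<bar>f z - z\<bar>"
        using powr_le_self_of_ge_1[of "1 + gain a p + 2 * displ z p" s] s g0 by (simp add: displ_def p)
      consider "p \<notin> A n" | "p \<in> ?B1" "p \<notin> ?B2" "p \<notin> ?B3" "p \<in> A n"
        | "p \<notin> ?B1" "p \<in> ?B2" "p \<notin> ?B3" "p \<in> A n"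
        | "p \<notin> ?B1" "p \<notin> ?B2" "p \<in> ?B3" "p \<in> A n"
        using ab \<open>0 \<le> t\<close> by (fastforce simp: A_def box3_def p)
      then show "ennreal (g n p) * indicator (A n) p
          \<le> ?h1 (snd (snd p)) * indicator ?B1 p + ?h2 (snd (snd p)) * indicator ?B2 p + ?h3 (snd (snd p)) * indicator ?B3 p"
      proof cases
        case 2
        then have "g n p = lipconst f powr s" by (simp add: g_def w_def p box3_def gain_def)
        with 2 show ?thesis by (simp add: p)
      next
        case 3
        then have "g n p = (3 * max 1 (lipconst f)) powr s" by (simp add: g_def w_def p box3_def gain_def)
        with 3 m2 show ?thesis by (simp add: p ennreal_leI)
      next
        case 4
        then have "g n p = (1 + gain a p + 2 * displ z p) powr s" by (simp add: g_def w_def p box3_def)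
        with 4 m3 show ?thesis by (simp add: p ennreal_leI)
      qed simp
    qed
    also have "\<dots> = (\<integral>\<^sup>+ p\<in>?B1. ?h1 (snd (snd p)) \<partial>intensity \<nu>) + (\<integral>\<^sup>+ p\<in>?B2. ?h2 (snd (snd p)) \<partial>intensity \<nu>)
        + (\<integral>\<^sup>+ p\<in>?B3. ?h3 (snd (snd p)) \<partial>intensity \<nu>)"
      using B by (simp add: nn_integral_add)
    also have "(\<integral>\<^sup>+ p\<in>?B1. ?h1 (snd (snd p)) \<partial>intensity \<nu>)
        = emeasure lborel {0..<real n} * emeasure lborel {0..a} * (\<integral>\<^sup>+ f. ?h1 f \<partial>\<nu>)"
      by (rule nn_integral_box3) auto
    also have "(\<integral>\<^sup>+ p\<in>?B2. ?h2 (snd (snd p)) \<partial>intensity \<nu>)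
        = emeasure lborel {0..<real n} * emeasure lborel {a<..b} * (\<integral>\<^sup>+ f. ?h2 f \<partial>\<nu>)"
      by (rule nn_integral_box3) (use ab in auto)
    also have "(\<integral>\<^sup>+ p\<in>?B3. ?h3 (snd (snd p)) \<partial>intensity \<nu>)
        = emeasure lborel {real n..<real (Suc n)} * emeasure lborel {0..b} * (\<integral>\<^sup>+ f. ?h3 f \<partial>\<nu>)"
      by (rule nn_integral_box3) auto
    also have "emeasure lborel {0..<real n} * emeasure lborel {0..a} * (\<integral>\<^sup>+ f. ?h1 f \<partial>\<nu>)
        + emeasure lborel {0..<real n} * emeasure lborel {a<..b} * (\<integral>\<^sup>+ f. ?h2 f \<partial>\<nu>)
        + emeasure lborel {real n..<real (Suc n)} * emeasure lborel {0..b} * (\<integral>\<^sup>+ f. ?h3 f \<partial>\<nu>)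
        \<le> ennreal (real n) * ennreal a * ennreal \<rho> + ennreal (real n) * ennreal (b - a) * ennreal \<kappa>
        + ennreal 1 * ennreal b * ennreal \<eta>"
      using \<rho>(2) \<kappa>(2) \<eta>(2) ab by (intro add_mono mult_mono) auto
    also have "\<dots> = ennreal (K n)"
      using ab \<rho>(1) \<kappa>(1) \<eta>(1) by (simp add: K_def ennreal_mult ennreal_plus)
    finally show ?thesis .
  qed
  have "\<forall>n. \<exists>Z. Z \<in> borel_measurable M \<and> (AE \<omega> in M. (\<Prod>p\<in>P \<omega> \<inter> A n. ennreal (g n p)) = Z \<omega>) \<and>
      (\<integral>\<^sup>+ \<omega>. Z \<omega> \<partial>M) \<le> ennreal (exp (K n - (real n + 1) * b))"
  proof
    fix n
    show "\<exists>Z. Z \<in> borel_measurable M \<and> (AE \<omega> in M. (\<Prod>p\<in>P \<omega> \<inter> A n. ennreal (g n p)) = Z \<omega>) \<and>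
        (\<integral>\<^sup>+ \<omega>. Z \<omega> \<partial>M) \<le> ennreal (exp (K n - (real n + 1) * b))"
      using poisson_process_product_bound[OF PP A fA g K0 intK, of n] unfolding mA by blast
  qed
  from choice[OF this] obtain Z where Z: "\<And>n. Z n \<in> borel_measurable M"
      "\<And>n. AE \<omega> in M. (\<Prod>p\<in>P \<omega> \<inter> A n. ennreal (g n p)) = Z n \<omega>"
      "\<And>n. (\<integral>\<^sup>+ \<omega>. Z n \<omega> \<partial>M) \<le> ennreal (exp (K n - (real n + 1) * b))"
    by blast
  define d where "d = b - (a * \<rho> + (b - a) * \<kappa>)"
  have d: "d > 0" using contr by (simp add: d_def)
  \<comment> \<open>Subtracting the measure of \<open>A n\<close> costs \<open>b\<close> per unit of
    time, which leaves the drift \<open>- d\<close>.\<close>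
  have expK: "exp (K n - (real n + 1) * b) = exp (b * \<eta> - b) * exp (- d) ^ n" for n
    by (simp add: K_def d_def algebra_simps flip: exp_add exp_of_nat_mult)
  have sm: "summable (\<lambda>n. exp (K n - (real n + 1) * b))"
    unfolding expK using d by (intro summable_mult summable_geometric) auto
  have "(\<integral>\<^sup>+ \<omega>. (\<Sum>n. Z n \<omega>) \<partial>M) = (\<Sum>n. \<integral>\<^sup>+ \<omega>. Z n \<omega> \<partial>M)"
    by (rule nn_integral_suminf[OF Z(1)])
  also have "\<dots> \<le> (\<Sum>n. ennreal (exp (K n - (real n + 1) * b)))"
    by (intro suminf_le Z(3)) auto
  also have "\<dots> < \<infinity>" using sm by (simp add: suminf_ennreal2)
  finally have "AE \<omega> in M. (\<Sum>n. Z n \<omega>) \<noteq> \<infinity>"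
    using Z(1) by (intro nn_integral_PInf_AE) auto
  moreover have "AE \<omega> in M. \<forall>n. (\<Prod>p\<in>P \<omega> \<inter> A n. ennreal (g n p)) = Z n \<omega>"
    using Z(2) by (simp add: AE_all_countable)
  ultimately show ?thesis using AE_point_config[OF PP] AE_space
  proof eventually_elim
    fix \<omega> assume fin: "(\<Sum>n. Z n \<omega>) \<noteq> \<infinity>" and eq: "\<forall>n. (\<Prod>p\<in>P \<omega> \<inter> A n. ennreal (g n p)) = Z n \<omega>"
      and conf: "\<forall>b. point_config (P \<omega>) b" and \<omega>: "\<omega> \<in> space M"
    interpret point_config "P \<omega>" b using conf by blast
    define W where "W n = (\<Prod>p\<in>before n. gain a p) * (\<Prod>p\<in>slot n. 1 + gain a p + 2 * displ z p)" for n
    have P: "p \<in> {0..} \<times> {0..} \<times> lipG" if "p \<in> P \<omega>" for p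
      using PP \<omega> that unfolding poisson_process_def space_intensity by blast
    have w0: "0 \<le> w n p" if "p \<in> P \<omega>" for n p
      using gain_nonneg[OF lip[OF that], of a] by (simp add: w_def)
    have PA: "P \<omega> \<inter> A n = before n \<union> slot n" for n
      using P by (force simp: A_def box3_def before_def slot_def)
    have W: "W n = (\<Prod>p\<in>P \<omega> \<inter> A n. w n p)" for n
    proof -
      have "(\<Prod>p\<in>P \<omega> \<inter> A n. w n p) = (\<Prod>p\<in>before n. w n p) * (\<Prod>p\<in>slot n. w n p)"
        unfolding PA by (rule prod.union_disjoint) (use finite_before finite_slot in \<open>auto simp: before_def slot_def\<close>)
      also have "\<dots> = W n"
        unfolding W_def by (intro arg_cong2[where f = "(*)"] prod.cong) (auto simp: w_def before_def slot_def)
      finally show ?thesis ..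
    qed
    have W0: "0 \<le> W n" for n unfolding W using w0 by (intro prod_nonneg) auto
    have "Z n \<omega> = ennreal (W n powr s)" for n
    proof -
      have "Z n \<omega> = (\<Prod>p\<in>P \<omega> \<inter> A n. ennreal (g n p))" using eq by simp
      also have "\<dots> = ennreal (\<Prod>p\<in>P \<omega> \<inter> A n. g n p)" by (rule prod_ennreal) (simp add: g_def)
      also have "(\<Prod>p\<in>P \<omega> \<inter> A n. g n p) = W n powr s"
        unfolding g_def W using w0 by (intro prod_powr) auto
      finally show ?thesis .
    qed
    with fin have "(\<Sum>n. ennreal (W n powr s)) \<noteq> \<top>" by simp
    then have smW: "summable (\<lambda>n. W n powr s)" by (intro summable_suminf_not_top) auto
    \<comment> \<open>Summable powers tend to 0, so eventually \<open>W n \<le> 1\<close>, and there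
      \<open>W n \<le> W n powr s\<close>.\<close>
    have "summable W"
    proof (rule summable_comparison_test_ev[OF _ smW])
      have "\<forall>\<^sub>F n in sequentially. W n powr s < 1"
        using order_tendstoD(2)[OF summable_LIMSEQ_zero[OF smW], of 1] by simp
      then show "\<forall>\<^sub>F n in sequentially. norm (W n) \<le> W n powr s"
      proof eventually_elim
        fix n assume lt: "W n powr s < 1"
        have "W n \<le> 1"
        proof (rule ccontr)
          assume "\<not> W n \<le> 1"
          then have "1 \<le> W n powr s" using s by (intro ge_one_powr_ge_zero) auto
          with lt show False by simp
        qed
        then have "W n powr 1 \<le> W n powr s" using W0[of n] s by (intro powr_mono') auto
        then show "norm (W n) \<le> W n powr s" using W0[of n] by simp
      qed
    qed
    then show "summable (\<lambda>n. (\<Prod>p\<in>before n. gain a p) * (\<Prod>p\<in>slot n. 1 + gain a p + 2 * displ z p))"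
      by (simp add: W_def[abs_def])
  qed
qed

end

section \<open>Constants of the model and the covering by rational cells\<close>

theorem theorem5p4:
  fixes \<nu> :: "(real \<Rightarrow> real) measure"
    and M :: "'w measure"
    and P :: "'w \<Rightarrow> (real \<times> real \<times> (real \<Rightarrow> real)) set"
    and z0 :: real
  assumes nu_prob: "prob_space \<nu>"
    and nu_sets: "sets \<nu> = sets G_borel"
    and EL: "(\<integral>\<^sup>+ f. ennreal (lipconst f) \<partial>\<nu>) < \<infinity>"
    and Elog: "exp_log_lip_neg \<nu>"
    and Ez0: "(\<integral>\<^sup>+ f. ennreal \<bar>f z0 - z0\<bar> \<partial>\<nu>) < \<infinity>"
    and PP: "poisson_process M P (intensity \<nu>)"
  shows "AE \<omega> in M. \<forall>a b. 0 < a \<and> a < b \<longrightarrow>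
           total_variation (zeta (P \<omega>) z0) a b < \<infinity>"
proof -
  interpret lip_prob \<nu> using nu_prob nu_sets by (simp add: lip_prob_def lip_prob_axioms_def)
  obtain s where s: "0 < s" "s \<le> 1" "(\<integral>\<^sup>+ f. ennreal (lipconst f powr s) \<partial>\<nu>) < 1"
    using exists_contracting_moment[OF nu_prob nu_sets EL Elog] .
  define \<rho> where "\<rho> = enn2real (\<integral>\<^sup>+ f. ennreal (lipconst f powr s) \<partial>\<nu>)"
  have \<rho>: "ennreal \<rho> = (\<integral>\<^sup>+ f. ennreal (lipconst f powr s) \<partial>\<nu>)" "0 \<le> \<rho>" "\<rho> < 1"
  proof -
    show eq: "ennreal \<rho> = (\<integral>\<^sup>+ f. ennreal (lipconst f powr s) \<partial>\<nu>)"
      unfolding \<rho>_def using s(3) by (intro ennreal_enn2real) (auto intro: less_trans)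
    show "0 \<le> \<rho>" by (simp add: \<rho>_def)
    show "\<rho> < 1" using s(3) by (simp flip: eq)
  qed
  define l where "l = enn2real (\<integral>\<^sup>+ f. ennreal (lipconst f) \<partial>\<nu>)"
  have l: "ennreal l = (\<integral>\<^sup>+ f. ennreal (lipconst f) \<partial>\<nu>)" "0 \<le> l"
    using EL by (auto simp: l_def)
  define c where "c = enn2real (\<integral>\<^sup>+ f. ennreal \<bar>f z0 - z0\<bar> \<partial>\<nu>)"
  have c: "ennreal c = (\<integral>\<^sup>+ f. ennreal \<bar>f z0 - z0\<bar> \<partial>\<nu>)" "0 \<le> c"
    using Ez0 by (auto simp: c_def)
  have L0: "0 \<le> lipconst f" if "f \<in> space \<nu>" for f using that by (simp add: space_nu lipconst_nonneg)
  \<comment> \<open>Bounds the mean of \<open>3 * max 1 L\<close> through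
    \<open>max 1 L \<le> 1 + L\<close>; \<open>\<eta>\<close> likewise bounds the mean slot
    factor.\<close>
  define \<kappa> where "\<kappa> = 3 + 3 * l"
  have \<kappa>: "0 \<le> \<kappa>" "(\<integral>\<^sup>+ f. ennreal (3 + 3 * lipconst f) \<partial>\<nu>) \<le> ennreal \<kappa>"
  proof -
    have "(\<integral>\<^sup>+ f. ennreal (3 + 3 * lipconst f) \<partial>\<nu>) = (\<integral>\<^sup>+ f. ennreal 3 + ennreal 3 * ennreal (lipconst f) \<partial>\<nu>)"
      using L0 by (intro nn_integral_cong) (simp add: ennreal_plus ennreal_mult)
    also have "\<dots> = ennreal 3 + ennreal 3 * ennreal l"
      unfolding l by (simp add: nn_integral_add nn_integral_cmult emeasure_space_1 del: ennreal_numeral)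
    finally show "(\<integral>\<^sup>+ f. ennreal (3 + 3 * lipconst f) \<partial>\<nu>) \<le> ennreal \<kappa>"
      using l(2) by (simp add: \<kappa>_def ennreal_plus ennreal_mult del: ennreal_numeral)
  qed (use l in \<open>simp add: \<kappa>_def\<close>)
  define \<eta> where "\<eta> = 4 + 3 * l + 2 * c"
  have \<eta>: "0 \<le> \<eta>" "(\<integral>\<^sup>+ f. ennreal (4 + 3 * lipconst f + 2 * \<bar>f z0 - z0\<bar>) \<partial>\<nu>) \<le> ennreal \<eta>"
  proof -
    have "(\<integral>\<^sup>+ f. ennreal (4 + 3 * lipconst f + 2 * \<bar>f z0 - z0\<bar>) \<partial>\<nu>)
        = (\<integral>\<^sup>+ f. ennreal 4 + ennreal 3 * ennreal (lipconst f) + ennreal 2 * ennreal \<bar>f z0 - z0\<bar> \<partial>\<nu>)"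
      using L0 by (intro nn_integral_cong) (simp add: ennreal_plus ennreal_mult)
    also have "\<dots> = ennreal 4 + ennreal 3 * ennreal l + ennreal 2 * ennreal c"
      unfolding l c by (simp add: nn_integral_add nn_integral_cmult emeasure_space_1 del: ennreal_numeral)
    finally show "(\<integral>\<^sup>+ f. ennreal (4 + 3 * lipconst f + 2 * \<bar>f z0 - z0\<bar>) \<partial>\<nu>) \<le> ennreal \<eta>"
      using l(2) c(2) by (simp add: \<eta>_def ennreal_plus ennreal_mult del: ennreal_numeral)
  qed (use l c in \<open>simp add: \<eta>_def\<close>)
  \<comment> \<open>The length \<open>1 / N\<close> is the fraction \<open>1 / k\<close> of the left
    endpoint, so the contraction condition becomes \<open>\<kappa> < k * (1 - \<rho>)\<close>, free
    of \<open>N\<close>.\<close>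
  have cell: "AE \<omega> in M. 0 < N \<and> \<kappa> < real k * (1 - \<rho>) \<longrightarrow>
      bvar (zeta (P \<omega>) z0) (real k / real N) (real (Suc k) / real N)" for N k :: nat
  proof (cases "0 < N \<and> \<kappa> < real k * (1 - \<rho>)")
    case True
    define a b where "a = real k / real N" and "b = real (Suc k) / real N"
    have "k \<noteq> 0" using True \<kappa>(1) by (intro notI) simp
    then have ab: "0 < a" "a < b" using True by (auto simp: a_def b_def divide_strict_right_mono)
    have "(b - a) * \<kappa> < a * (1 - \<rho>)"
      using True by (simp add: a_def b_def field_simps flip: diff_divide_distrib)
    then have "a * \<rho> + (b - a) * \<kappa> < b" using ab by (simp add: algebra_simps)
    from AE_summable_weights[OF PP ab s(1,2) \<rho>(2) eq_refl[OF \<rho>(1)[symmetric]] \<kappa> \<eta> this] AE_point_config[OF PP]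
    have "AE \<omega> in M. bvar (zeta (P \<omega>) z0) a b"
      by eventually_elim (use point_config.bvar_zeta in blast)
    then show ?thesis by (simp add: a_def b_def)
  next
    case False
    then show ?thesis by (intro AE_I2) blast
  qed
  then have "AE \<omega> in M. \<forall>N k. 0 < N \<and> \<kappa> < real k * (1 - \<rho>) \<longrightarrow>
      bvar (zeta (P \<omega>) z0) (real k / real N) (real (Suc k) / real N)"
    by (simp add: AE_all_countable)
  then show ?thesis
  proof (eventually_elim, intro allI impI)
    fix \<omega> and a b :: real
    assume cells: "\<forall>N k. 0 < N \<and> \<kappa> < real k * (1 - \<rho>) \<longrightarrow>
      bvar (zeta (P \<omega>) z0) (real k / real N) (real (Suc k) / real N)" and ab: "0 < a \<and> a < b"
    \<comment> \<open>First \<open>k\<close> makes this cell and all later ones admissible, then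
      \<open>N\<close> moves the starting point \<open>k / N\<close> below \<open>a\<close>.\<close>
    obtain k :: nat where k: "\<kappa> < real k * (1 - \<rho>)" using ex_less_of_nat_mult[of "1 - \<rho>" \<kappa>] \<rho>(3) by auto
    obtain N :: nat where N: "real k + 1 < real N * a" using ex_less_of_nat_mult[of a] ab by blast
    have N0: "N > 0" using N by (cases N) auto
    obtain j :: nat where j: "b * real N \<le> real j" using real_arch_simple by blast
    have "bvar (zeta (P \<omega>) z0) (real k / real N) (real (k + Suc i) / real N)" for i
    proof (induction i)
      case 0
      show ?case using cells k N0 by auto
    next
      case (Suc i)
      have "real k * (1 - \<rho>) \<le> real (k + Suc i) * (1 - \<rho>)" using \<rho>(3) by (intro mult_right_mono) auto
      with k have "\<kappa> < real (k + Suc i) * (1 - \<rho>)" by linarith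
      with cells N0 have "bvar (zeta (P \<omega>) z0) (real (k + Suc i) / real N) (real (Suc (k + Suc i)) / real N)"
        by blast
      from bvar_concat[OF Suc this] show ?case by simp
    qed
    from this[of j] have "bvar (zeta (P \<omega>) z0) a b"
    proof (rule bvar_subinterval)
      show "real k / real N \<le> a" using N N0 by (simp add: field_simps)
      have "b \<le> real j / real N" using j N0 by (simp add: field_simps)
      also have "\<dots> \<le> real (k + Suc j) / real N" by (intro divide_right_mono) auto
      finally show "b \<le> real (k + Suc j) / real N" .
    qed
    then show "total_variation (zeta (P \<omega>) z0) a b < \<infinity>" by (rule bvar_total_variation)
  qed
qed


end
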